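(* Suppose the ellipticity assumption holds on $U$ and $|b(x)|\le M_2$ for all $x\in U$ with a constant $M_2\ge0$. There exist constants $C_*>0$ and $\nu>0$ (independent of $u$) such that the following holds for every $u\in C^2(U)\cap C(\widetilde U)$ that is bounded on $\gamma$, is below exponential growth in $\widetilde U$, and satisfies $Lu=0$ in $U$: $$\operatorname*{osc}_{x\in \widetilde U}u(x) \le \operatorname*{osc}_{x\in \mathcal S_{\theta_0}\cup\gamma}u(x),$$ $$\operatorname*{osc}_{x\in \mathcal S_\theta}u(x) \le\Big(\operatorname*{osc}_{x\in \gamma}u(x)\Big)\big(1-C_*e^{-\nu(\theta-\theta_0)}\big) + C_*\Big(\operatorname*{osc}_{x\in \mathcal S_{\theta_0}\cup\gamma}u(x)\Big) e^{-\nu(\theta-\theta_0)}\quad\text{for all }\theta\ge\theta_0.$$ Consequently, $$\limsup_{\theta\to\infty}\Big(\operatorname*{osc}_{x\in \mathcal S_\theta}u(x)\Big)\le \limsup_{\theta\to\infty}M_\gamma(\theta)-\liminf_{\theta\to\infty}m_\gamma(\theta).$$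
   Context: Domain. Let $X(r,\theta)=(r\cos\theta,r\sin\theta)$ for $r\ge0$, $\theta\in\mathbb R$. Fix $\theta_0\in\mathbb R$ and positive continuous functions $r_1,r_2$ on $[\theta_0,\infty)$ with $r_2(\theta+2\pi)<r_1(\theta)<r_2(\theta)$ for all $\theta\ge\theta_0$, and assume there is $r_*>0$ with $\lim_{\theta\to\infty}r_1(\theta)=\lim_{\theta\to\infty}r_2(\theta)=r_*$. Define $U=\{X(r,\theta):\theta>\theta_0,\ r_1(\theta)<r<r_2(\theta)\}$ (open and bounded), $\widetilde U=\{X(r,\theta):\theta\ge\theta_0,\ r_1(\theta)\le r\le r_2(\theta)\}$, $\gamma=\{X(r_i(\theta),\theta):\theta\ge\theta_0,\ i=1,2\}$, and $\mathcal S_\theta=\{X(r,\theta): r_1(\theta)\le r\le r_2(\theta)\}$ for $\theta\ge\theta_0$. Operator. $A=(a_{ij})$ is a function from $U$ to the real symmetric $2\times2$ matrices, $b:U\to\mathbb R^2$, and $Lu=-\sum_{i,j=1}^2 a_{ij}\frac{\partial^2u}{\partial x_i\partial x_j}+b\cdot\nabla u$ for $u\in C^2(U)$. Ellipticity assumption on $U$: there are constants $c_0>0$, $M_1>0$ such that $\xi^{\rm T}A(x)\xi\ge c_0|\xi|^2$ and $\mathrm{Tr}(A(x))\le M_1$ for all $x\in U$, $\xi\in\mathbb R^2$. A function $u:\widetilde U\to\mathbb R$ is below exponential growth in $\widetilde U$ if for any $\varepsilon>0$, $\lim_{\theta\to\infty}\big(e^{-\varepsilon\theta}\sup_{x\in\mathcal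 S_\theta}|u(x)|\big)=0$. Notation: $\operatorname{osc}_{x\in K}u(x)=\sup_Ku-\inf_Ku$; for $\theta\ge\theta_0$, $M_\gamma(\theta)=\max\{u(X(r_i(\theta),\theta)):i=1,2\}$, $m_\gamma(\theta)=\min\{u(X(r_i(\theta),\theta)):i=1,2\}$. *)

theory Defs
  imports "HOL-Analysis.Analysis"
begin

definition polar :: "real \<Rightarrow> real \<Rightarrow> real^2" where
  "polar r \<theta> = vector [r * cos \<theta>, r * sin \<theta>]"

definition spiral_slice :: "(real \<Rightarrow> real) \<Rightarrow> (real \<Rightarrow> real) \<Rightarrow> real \<Rightarrow> (real^2) set" where
  "spiral_slice r1 r2 \<theta> = {polar r \<theta> | r. r1 \<theta> \<le> r \<and> r \<le> r2 \<theta>}"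

definition spiral_open :: "real \<Rightarrow> (real \<Rightarrow> real) \<Rightarrow> (real \<Rightarrow> real) \<Rightarrow> (real^2) set" where
  "spiral_open \<theta>0 r1 r2 = {polar r \<theta> | r \<theta>. \<theta>0 < \<theta> \<and> r1 \<theta> < r \<and> r < r2 \<theta>}"

definition spiral_full :: "real \<Rightarrow> (real \<Rightarrow> real) \<Rightarrow> (real \<Rightarrow> real) \<Rightarrow> (real^2) set" where
  "spiral_full \<theta>0 r1 r2 = {polar r \<theta> | r \<theta>. \<theta>0 \<le> \<theta> \<and> r1 \<theta> \<le> r \<and> r \<le> r2 \<theta>}"

definition spiral_sides :: "real \<Rightarrow> (real \<Rightarrow> real) \<Rightarrow> (real \<Rightarrow> real) \<Rightarrow> (real^2) set" where
  "spiral_sides \<theta>0 r1 r2 =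
     {polar (r1 \<theta>) \<theta> | \<theta>. \<theta>0 \<le> \<theta>} \<union> {polar (r2 \<theta>) \<theta> | \<theta>. \<theta>0 \<le> \<theta>}"

text \<open>On an open set, the derivatives below depend only on the restriction of the function to
  that set, so functions on a set are represented by total functions.\<close>

definition partial_deriv :: "2 \<Rightarrow> (real^2 \<Rightarrow> real) \<Rightarrow> real^2 \<Rightarrow> real" where
  "partial_deriv i u x = frechet_derivative u (at x) (axis i 1)"

definition gradient :: "(real^2 \<Rightarrow> real) \<Rightarrow> real^2 \<Rightarrow> real^2" where
  "gradient u x = (\<chi> i. partial_deriv i u x)"

definition C1_on :: "(real^2) set \<Rightarrow> (real^2 \<Rightarrow> real) \<Rightarrow> bool" where
  "C1_on U u \<longleftrightarrow>
     (\<forall>x\<in>U. u differentiable (at x)) \<and> (\<forall>i. continuous_on U (partial_deriv i u))"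

definition C2_on :: "(real^2) set \<Rightarrow> (real^2 \<Rightarrow> real) \<Rightarrow> bool" where
  "C2_on U u \<longleftrightarrow> C1_on U u \<and> (\<forall>i. C1_on U (partial_deriv i u))"

definition elliptic_op ::
  "(real^2 \<Rightarrow> real^2^2) \<Rightarrow> (real^2 \<Rightarrow> real^2) \<Rightarrow> (real^2 \<Rightarrow> real) \<Rightarrow> real^2 \<Rightarrow> real" where
  "elliptic_op A b u x =
     - (\<Sum>i\<in>UNIV. \<Sum>j\<in>UNIV. A x $ i $ j * partial_deriv i (partial_deriv j u) x)
     + b x \<bullet> gradient u x"

text \<open>Suprema and infima are taken in the extended reals: a real-valued \<open>Sup\<close> would be an
  unspecified value on unbounded sets, whereas here a bound by a finite oscillation
  includes boundedness.\<close>

definition osc :: "('a \<Rightarrow> real) \<Rightarrow> 'a set \<Rightarrow> ereal" where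
  "osc u K = (SUP x\<in>K. ereal (u x)) - (INF x\<in>K. ereal (u x))"

definition below_exp_growth :: "(real \<Rightarrow> real) \<Rightarrow> (real \<Rightarrow> real) \<Rightarrow> (real^2 \<Rightarrow> real) \<Rightarrow> bool" where
  "below_exp_growth r1 r2 u \<longleftrightarrow>
     (\<forall>\<epsilon>>0. ((\<lambda>\<theta>. ereal (exp (- \<epsilon> * \<theta>)) * (SUP x\<in>spiral_slice r1 r2 \<theta>. ereal \<bar>u x\<bar>))
        \<longlongrightarrow> 0) at_top)"

definition side_max :: "(real \<Rightarrow> real) \<Rightarrow> (real \<Rightarrow> real) \<Rightarrow> (real^2 \<Rightarrow> real) \<Rightarrow> real \<Rightarrow> real" where
  "side_max r1 r2 u \<theta> = max (u (polar (r1 \<theta>) \<theta>)) (u (polar (r2 \<theta>) \<theta>))"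

definition side_min :: "(real \<Rightarrow> real) \<Rightarrow> (real \<Rightarrow> real) \<Rightarrow> (real^2 \<Rightarrow> real) \<Rightarrow> real \<Rightarrow> real" where
  "side_min r1 r2 u \<theta> = min (u (polar (r1 \<theta>) \<theta>)) (u (polar (r2 \<theta>) \<theta>))"

end

theory Submission
  imports Defs
begin

text \<open>
  The estimate is a comparison argument of Phragmen--Lindelof type. The one function needed is the
  barrier \<open>w s x \<theta> = exp (s * \<theta>) * (2 * m - exp (lam * x$1))\<close>, where \<open>\<theta>\<close> is the continuous polar angle
  along the spiral. The factor \<open>2 * m - exp (lam * x$1)\<close> is a strict supersolution, of size between
  \<open>m\<close> and \<open>2 * m\<close> on the bounded domain, as soon as \<open>lam\<close> is so large that the second derivative
  \<open>lam\<^sup>2\<close> (times \<open>c0\<close>) beats the drift \<open>lam * M2\<close>. Since the radii stay away from \<open>0\<close>, the first two derivatives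
  of the angle are bounded, and the factor \<open>exp (s * \<theta>)\<close> disturbs strict positivity by \<open>O(\<bar>s\<bar>)\<close> only:
  for small \<open>\<nu> > 0\<close> both \<open>w \<nu>\<close> and \<open>w (- \<nu>)\<close> are strict supersolutions
  (lemma \<open>barrier_strict_supersolution\<close>).

  If \<open>u \<le> K\<close> on the sides and \<open>u \<le> K'\<close> on the slice at \<open>\<theta>1\<close>, compare \<open>u\<close> with \<open>K\<close> plus a
  multiple \<open>\<delta>\<close> of the decaying barrier, which pays for the excess \<open>K' - K\<close> at \<open>\<theta>1\<close>, plus
  \<open>\<epsilon>\<close> times the growing barrier, which dominates \<open>u\<close> far out because \<open>u\<close> grows more slowly than every
  exponential. An interior maximum of the difference contradicts the strict inequality
  (\<open>no_interior_maximum\<close>), and \<open>\<epsilon> \<rightarrow> 0\<close> gives \<open>u \<le> K + 2 * (K' - K) * exp (- \<nu> * (\<theta> - \<theta>1))\<close>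
  (\<open>comparison\<close>); the factor \<open>2\<close> is the ratio of the bounds on the barrier.
  Applied to \<open>u\<close> and \<open>- u\<close> this yields all three claims: \<open>K = K'\<close> is the
  maximum principle, \<open>\<theta>1 = \<theta>0\<close> is the exponential decay, and \<open>\<theta>1 \<rightarrow> \<infinity>\<close> is the bound on the upper limit.

  The coefficients carry no regularity, so the second-order condition at a maximum is used pointwise.
  Writing \<open>A = p p\<^sup>T + q q\<^sup>T\<close> turns \<open>\<Sum> a\<^sub>i\<^sub>j \<partial>\<^sub>i \<partial>\<^sub>j\<close> into two second
  derivatives along straight lines, and both \<open>u\<close> and the barrier are only ever differentiated along
  lines, where the angle has the explicit expression \<open>line_angle\<close>.
\<close>

section \<open>Second-order calculus along straight lines\<close>

lemma second_derivative_test: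
  fixes f f' :: "real \<Rightarrow> real"
  assumes f': "\<forall>\<^sub>F t in nhds 0. (f has_real_derivative f' t) (at t)"
    and f'': "(f' has_real_derivative f2) (at 0)"
    and max: "\<forall>\<^sub>F t in nhds 0. f t \<le> f 0"
  shows "f' 0 = 0" and "f2 \<le> 0"
proof -
  from eventually_conj[OF f' max] obtain d where d: "d > 0"
    and D: "\<And>t. \<bar>t\<bar> < d \<Longrightarrow> (f has_real_derivative f' t) (at t) \<and> f t \<le> f 0"
    unfolding eventually_nhds_metric by (auto simp: dist_real_def)
  have D0: "(f has_real_derivative f' 0) (at 0)" using D[of 0] d by auto
  show z: "f' 0 = 0"
    by (rule DERIV_local_max[OF D0 d]) (use D in auto)
  show "f2 \<le> 0"
  proof (rule ccontr)
    assume "\<not> f2 \<le> 0"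
    then have "f2 > 0" by simp
    from DERIV_pos_inc_right[OF f'' this] obtain e where e: "e > 0"
      and E: "\<And>h. 0 < h \<Longrightarrow> h < e \<Longrightarrow> f' h > 0" using z by auto
    define h where "h = min d e / 2"
    have h: "0 < h" "h < d" "h < e" using d e by (auto simp: h_def)
    obtain \<xi> where "0 < \<xi>" "\<xi> < h" "f h - f 0 = (h - 0) * f' \<xi>"
      using MVT2[of 0 h f f'] D h by force
    moreover have "f h \<le> f 0" using D[of h] h by auto
    moreover have "h * f' \<xi> > 0" using E[of \<xi>] h calculation by auto
    ultimately show False by simp
  qed
qed

lemma has_real_derivative_along_line:
  fixes u :: "real^2 \<Rightarrow> real"
  assumes "u differentiable (at (x + t *\<^sub>R \<xi>))"
  shows "((\<lambda>t. u (x + t *\<^sub>R \<xi>)) has_real_derivative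
    (\<Sum>i\<in>UNIV. \<xi> $ i * partial_deriv i u (x + t *\<^sub>R \<xi>))) (at t)"
proof -
  let ?y = "x + t *\<^sub>R \<xi>"
  have D: "(u has_derivative frechet_derivative u (at ?y)) (at ?y)"
    using assms by (simp add: frechet_derivative_works)
  have L: "((\<lambda>t. x + t *\<^sub>R \<xi>) has_derivative (\<lambda>h. h *\<^sub>R \<xi>)) (at t)"
    by (auto intro!: derivative_eq_intros)
  have lin: "linear (frechet_derivative u (at ?y))"
    using D has_derivative_linear by blast
  have "frechet_derivative u (at ?y) \<xi> = frechet_derivative u (at ?y) (\<Sum>i\<in>UNIV. \<xi> $ i *\<^sub>R axis i 1)"
    by (simp add: basis_expansion flip: scalar_mult_eq_scaleR)
  also have "\<dots> = (\<Sum>i\<in>UNIV. \<xi> $ i * partial_deriv i u ?y)"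
    by (simp add: linear_sum[OF lin] linear_cmul[OF lin] partial_deriv_def)
  finally have e: "frechet_derivative u (at ?y) \<xi> = (\<Sum>i\<in>UNIV. \<xi> $ i * partial_deriv i u ?y)" .
  show ?thesis
    using diff_chain_at[OF L D] unfolding has_field_derivative_def o_def
    by (simp add: linear_cmul[OF lin] e mult.commute[of _ "sum _ _"])
qed

text \<open>The order of the mixed partial derivatives is the one that differentiating
  twice produces, and that in which they occur in
  \<open>elliptic_op\<close>.\<close>

lemma second_derivative_along_line:
  fixes u :: "real^2 \<Rightarrow> real"
  assumes "\<And>i. partial_deriv i u differentiable (at x)"
  shows "((\<lambda>t. \<Sum>j\<in>UNIV. \<xi> $ j * partial_deriv j u (x + t *\<^sub>R \<xi>)) has_real_derivative
    (\<Sum>i\<in>UNIV. \<Sum>j\<in>UNIV. \<xi> $ i * \<xi> $ j * partial_deriv i (partial_deriv j u) x)) (at 0)"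
proof -
  have "((\<lambda>t. partial_deriv j u (x + t *\<^sub>R \<xi>)) has_real_derivative
      (\<Sum>i\<in>UNIV. \<xi> $ i * partial_deriv i (partial_deriv j u) x)) (at 0)" for j
    using has_real_derivative_along_line[of "partial_deriv j u" x 0 \<xi>] assms by simp
  then show ?thesis
    by (auto intro!: derivative_eq_intros simp: sum_2 algebra_simps)
qed

lemma norm_sq_real2: "(norm (x :: real^2))\<^sup>2 = (x$1)\<^sup>2 + (x$2)\<^sup>2"
  by (simp only: power2_norm_eq_inner inner_vec_def sum_2) (simp add: power2_eq_square)

text \<open>The Cholesky factorization, that is, completing the square: with
  \<open>a = A\<^sub>1\<^sub>1 > 0\<close> and \<open>k = A\<^sub>1\<^sub>2 / a\<close> the quadratic form is \<open>a (x + k y)\<^sup>2 + d y\<^sup>2\<close>, and its value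
  at \<open>(- k, 1)\<close> shows \<open>d \<ge> 0\<close>.\<close>

lemma elliptic_matrix_sum_of_squares:
  fixes A :: "real^2^2"
  assumes sym: "transpose A = A" and c: "0 < c"
    and ell: "\<And>\<xi>. c * (norm \<xi>)\<^sup>2 \<le> \<xi> \<bullet> (A *v \<xi>)"
  obtains p q :: "real^2" where "\<And>i j. A $ i $ j = p $ i * p $ j + q $ i * q $ j"
proof -
  have s: "A $ 2 $ 1 = A $ 1 $ 2"
    using arg_cong[OF sym, of "\<lambda>M. M $ 1 $ 2"] by (simp add: transpose_def)
  have Q: "c * (x\<^sup>2 + y\<^sup>2) \<le> A$1$1 * x\<^sup>2 + 2 * A$1$2 * x * y + A$2$2 * y\<^sup>2" for x y
    using ell[of "vector [x, y]"] unfolding norm_sq_real2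
    by (simp add: inner_vec_def matrix_vector_mult_def sum_2 s
        power2_eq_square algebra_simps)
  have a: "A$1$1 > 0" using Q[of 1 0] c by simp
  define a k where "a = A$1$1" and "k = A$1$2 / A$1$1"
  define d where "d = A$2$2 - a * k\<^sup>2"
  have ak: "a * k = A$1$2" "a > 0" using a by (auto simp: a_def k_def)
  have "0 \<le> c * (k\<^sup>2 + 1)" using c by simp
  also have "\<dots> \<le> a * k\<^sup>2 - 2 * (a * k) * k + A$2$2"
    using Q[of "-k" 1] by (simp add: ak(1) flip: a_def)
  also have "\<dots> = d" by (simp add: d_def power2_eq_square algebra_simps)
  finally have d: "d \<ge> 0" .
  let ?p = "vector [sqrt a, sqrt a * k] :: real^2" and ?q = "vector [0, sqrt d] :: real^2"
  have ra: "sqrt a * sqrt a = a" "sqrt d * sqrt d = d" using ak d by auto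
  have "A $ i $ j = ?p $ i * ?p $ j + ?q $ i * ?q $ j" for i j
  proof -
    have "sqrt a * (sqrt a * k) = A$1$2" using ra ak by (metis mult.assoc)
    moreover have "sqrt a * k * (sqrt a * k) = a * k\<^sup>2"
      using ra by (metis mult.assoc mult.commute power2_eq_square)
    ultimately show ?thesis
      using exhaust_2[of i] exhaust_2[of j] s ra
      by (auto simp: d_def a_def mult.commute mult.left_commute)
  qed
  then show thesis by (rule that)
qed

section \<open>Polar coordinates along a straight line\<close>

definition radial_part :: "real \<Rightarrow> real^2 \<Rightarrow> real" where
  "radial_part \<theta> \<xi> = \<xi>$1 * cos \<theta> + \<xi>$2 * sin \<theta>"

definition tangential_part :: "real \<Rightarrow> real^2 \<Rightarrow> real" where
  "tangential_part \<theta> \<xi> = \<xi>$2 * cos \<theta> - \<xi>$1 * sin \<theta>"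

text \<open>The branch of the polar angle of \<open>polar r \<theta> + t *\<^sub>R \<xi>\<close> that equals
  \<open>\<theta>\<close> at \<open>t = 0\<close>; it is meaningful as long as the line stays in the open half plane around
  \<open>polar r \<theta>\<close>. Following the angle along one line at a time replaces a global angle function on the
  spiral.\<close>

definition line_angle :: "real \<Rightarrow> real \<Rightarrow> real^2 \<Rightarrow> real \<Rightarrow> real" where
  "line_angle r \<theta> \<xi> t =
     \<theta> + arctan (t * tangential_part \<theta> \<xi> / (r + t * radial_part \<theta> \<xi>))"

lemma norm_sq_frame: "(radial_part \<theta> \<xi>)\<^sup>2 + (tangential_part \<theta> \<xi>)\<^sup>2 = (norm \<xi>)\<^sup>2"
proof -
  have "(radial_part \<theta> \<xi>)\<^sup>2 + (tangential_part \<theta> \<xi>)\<^sup>2 =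
      ((\<xi>$1)\<^sup>2 + (\<xi>$2)\<^sup>2) * ((sin \<theta>)\<^sup>2 + (cos \<theta>)\<^sup>2)"
    unfolding radial_part_def tangential_part_def by (simp only: power2_eq_square) algebra
  then show ?thesis by (simp add: norm_sq_real2)
qed

lemma polar_nth [simp]: "polar r \<theta> $ 1 = r * cos \<theta>" "polar r \<theta> $ 2 = r * sin \<theta>"
  by (simp_all add: polar_def)

lemma line_polar_coordinates:
  assumes pos: "0 < r + t * radial_part \<theta> \<xi>"
  shows "polar r \<theta> + t *\<^sub>R \<xi> =
    polar (norm (polar r \<theta> + t *\<^sub>R \<xi>)) (line_angle r \<theta> \<xi> t)"
proof -
  define p where "p = r + t * radial_part \<theta> \<xi>"
  define q where "q = t * tangential_part \<theta> \<xi>"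
  define n where "n = norm (polar r \<theta> + t *\<^sub>R \<xi>)"
  have p: "p > 0" using pos by (simp add: p_def)
  have sc: "(sin \<theta>)\<^sup>2 + (cos \<theta>)\<^sup>2 = 1" by simp
  have one: "(polar r \<theta> + t *\<^sub>R \<xi>) $ 1 = p * cos \<theta> - q * sin \<theta>"
    unfolding p_def q_def radial_part_def tangential_part_def vector_add_component
      vector_scaleR_component polar_nth real_scaleR_def
    using sc by algebra
  have two: "(polar r \<theta> + t *\<^sub>R \<xi>) $ 2 = p * sin \<theta> + q * cos \<theta>"
    unfolding p_def q_def radial_part_def tangential_part_def vector_add_component
      vector_scaleR_component polar_nth real_scaleR_def
    using sc by algebra
  have "n\<^sup>2 = p\<^sup>2 + q\<^sup>2"
    unfolding n_def norm_sq_real2 one two using sc by algebra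
  then have n: "n = sqrt (p\<^sup>2 + q\<^sup>2)"
    by (metis n_def norm_ge_zero real_sqrt_unique)
  have "1 + (q / p)\<^sup>2 = (p\<^sup>2 + q\<^sup>2) / p\<^sup>2" using p by (simp add: field_simps)
  then have "sqrt (1 + (q / p)\<^sup>2) = n / p" using p by (simp add: n real_sqrt_divide)
  moreover have "n > 0" using p by (simp add: n add_pos_nonneg)
  moreover define \<psi> where "\<psi> = arctan (q / p)"
  ultimately have \<psi>: "n * cos \<psi> = p" "n * sin \<psi> = q"
    using p by (simp_all add: cos_arctan sin_arctan)
  have nc: "n * cos (\<theta> + \<psi>) = p * cos \<theta> - q * sin \<theta>"
    unfolding cos_add \<psi>[symmetric] by (simp add: algebra_simps)
  have ns: "n * sin (\<theta> + \<psi>) = p * sin \<theta> + q * cos \<theta>"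
    unfolding sin_add \<psi>[symmetric] by (simp add: algebra_simps)
  show ?thesis
    unfolding n_def[symmetric] vec_eq_iff forall_2 one two polar_nth line_angle_def
      p_def[symmetric] q_def[symmetric] \<psi>_def[symmetric]
    using nc ns by simp
qed

section \<open>The barrier and its derivatives along lines\<close>

text \<open>The angle is a separate argument because a point
  of the plane determines it only up to a full turn.\<close>

definition barrier :: "real \<Rightarrow> real \<Rightarrow> real \<Rightarrow> real^2 \<Rightarrow> real \<Rightarrow> real" where
  "barrier B l s x \<theta> = exp (s * \<theta>) * (B - exp (l * x $ 1))"

text \<open>The first and second derivative of the barrier at \<open>polar r \<theta>\<close> in the direction
  \<open>\<xi>\<close>, see \<open>barrier_along_line\<close>. They arise from the derivatives of the angle at \<open>t = 0\<close>, which are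
  \<open>a / r\<close> and \<open>- 2 * a * p / r\<^sup>2\<close> for the tangential part \<open>a\<close> and radial part \<open>p\<close> of \<open>\<xi>\<close>.\<close>

definition barrier_D1 :: "real \<Rightarrow> real \<Rightarrow> real \<Rightarrow> real \<Rightarrow> real \<Rightarrow> real^2 \<Rightarrow> real" where
  "barrier_D1 B l s r \<theta> \<xi> = (let E = exp (l * r * cos \<theta>) in
     exp (s * \<theta>) * (s * tangential_part \<theta> \<xi> / r * (B - E) - l * \<xi>$1 * E))"

definition barrier_D2 :: "real \<Rightarrow> real \<Rightarrow> real \<Rightarrow> real \<Rightarrow> real \<Rightarrow> real^2 \<Rightarrow> real" where
  "barrier_D2 B l s r \<theta> \<xi> = (let E = exp (l * r * cos \<theta>); a = tangential_part \<theta> \<xi> / r in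
     exp (s * \<theta>) * ((s\<^sup>2 * a\<^sup>2 - 2 * s * a * radial_part \<theta> \<xi> / r) * (B - E)
       - 2 * s * a * l * \<xi>$1 * E - l\<^sup>2 * (\<xi>$1)\<^sup>2 * E))"

lemma eventually_line_in_front:
  assumes "0 < r"
  shows "\<forall>\<^sub>F t in nhds 0. 0 < r + t * radial_part \<theta> \<xi>"
proof -
  have "((\<lambda>t. r + t * radial_part \<theta> \<xi>) \<longlongrightarrow> r + 0 * radial_part \<theta> \<xi>) (nhds 0)"
    by (intro tendsto_intros filterlim_ident)
  then show ?thesis using assms by (auto dest: order_tendstoD(1)[where a=0])
qed

lemma barrier_along_line:
  assumes r: "0 < r"
  obtains w' where
    "\<forall>\<^sub>F t in nhds 0. ((\<lambda>t. barrier B l s (polar r \<theta> + t *\<^sub>R \<xi>) (line_angle r \<theta> \<xi> t))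
        has_real_derivative w' t) (at t)"
    and "w' 0 = barrier_D1 B l s r \<theta> \<xi>"
    and "(w' has_real_derivative barrier_D2 B l s r \<theta> \<xi>) (at 0)"
proof -
  define a p where "a = tangential_part \<theta> \<xi>" and "p = radial_part \<theta> \<xi>"
  define h where "h = line_angle r \<theta> \<xi>"
  define h' where "h' t = a * r / ((r + t * p)\<^sup>2 + (t * a)\<^sup>2)" for t
  define E where "E t = exp (l * (r * cos \<theta> + t * \<xi> $ 1))" for t
  define w' where "w' t = exp (s * h t) * (s * h' t * (B - E t) - l * \<xi>$1 * E t)" for t
  have h_deriv: "(h has_real_derivative h' t) (at t)" if "0 < r + t * p" for t
  proof -
    have "((\<lambda>t. t * a / (r + t * p)) has_real_derivative
        (a * (r + t * p) - t * a * p) / ((r + t * p) * (r + t * p))) (at t)"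
      using that by (intro DERIV_divide) (auto intro!: derivative_eq_intros)
    from DERIV_add[OF DERIV_const[of \<theta>] DERIV_chain2[OF DERIV_arctan this]]
    have "(h has_real_derivative (a * (r + t * p) - t * a * p) / ((r + t * p) * (r + t * p))
         / (1 + (t * a / (r + t * p))\<^sup>2)) (at t)"
      unfolding h_def line_angle_def a_def p_def by (simp add: divide_inverse mult.commute)
    moreover have "(a * (r + t * p) - t * a * p) / ((r + t * p) * (r + t * p))
         / (1 + (t * a / (r + t * p))\<^sup>2) = h' t"
    proof -
      define P where "P = r + t * p"
      have P: "P > 0" using that by (simp add: P_def)
      have num: "a * P - t * a * p = a * r" by (simp add: P_def algebra_simps)
      have den: "P * P * (1 + (t * a / P)\<^sup>2) = P\<^sup>2 + (t * a)\<^sup>2"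
        using P by (simp add: field_simps power2_eq_square)
      show ?thesis unfolding h'_def P_def[symmetric] num
        by (simp only: divide_divide_eq_left den)
    qed
    ultimately show ?thesis by simp
  qed
  have E_deriv: "(E has_real_derivative l * \<xi>$1 * E t) (at t)" for t
    unfolding E_def by (auto intro!: derivative_eq_intros simp: algebra_simps)
  have 1: "\<forall>\<^sub>F t in nhds 0. ((\<lambda>t. barrier B l s (polar r \<theta> + t *\<^sub>R \<xi>) (line_angle r \<theta> \<xi> t))
        has_real_derivative w' t) (at t)"
    using eventually_line_in_front[OF r]
  proof (rule eventually_mono)
    fix t assume t: "0 < r + t * radial_part \<theta> \<xi>"
    have "((\<lambda>t. exp (s * h t) * (B - E t)) has_real_derivative w' t) (at t)"
      unfolding w'_def using t
      by (auto intro!: derivative_eq_intros h_deriv E_deriv simp: algebra_simps p_def)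
    then show "((\<lambda>t. barrier B l s (polar r \<theta> + t *\<^sub>R \<xi>) (line_angle r \<theta> \<xi> t))
        has_real_derivative w' t) (at t)"
      by (simp add: barrier_def h_def E_def)
  qed
  have z: "h 0 = \<theta>" "h' 0 = a / r" "E 0 = exp (l * r * cos \<theta>)"
    using r by (simp_all add: h_def line_angle_def h'_def E_def power2_eq_square mult.assoc)
  have 2: "w' 0 = barrier_D1 B l s r \<theta> \<xi>"
    by (simp add: w'_def barrier_D1_def z a_def Let_def)
  have "(h' has_real_derivative - (a * r * (2 * r * p)) / (r\<^sup>2 * r\<^sup>2)) (at 0)"
    unfolding h'_def using r
    by (auto intro!: derivative_eq_intros simp: power2_eq_square)
  then have h'_deriv: "(h' has_real_derivative - 2 * (a / r) * (p / r)) (at 0)"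
    using r by (simp add: field_simps power2_eq_square)
  have 3: "(w' has_real_derivative barrier_D2 B l s r \<theta> \<xi>) (at 0)"
    unfolding w'_def using r
    by (auto intro!: derivative_eq_intros h_deriv h'_deriv E_deriv
        simp: z barrier_D2_def Let_def simp flip: a_def p_def)
      (simp add: power2_eq_square field_simps)
  show thesis by (rule that[OF 1 2 3])
qed

text \<open>The next two bounds separate the terms caused by the angle, which are
  proportional to \<open>\<nu> = \<bar>s\<bar>\<close>, from the term of the exponential profile in \<open>x$1\<close>, which keeps its
  exact coefficient where it provides the strict sign.\<close>

lemma barrier_D1_ge:
  assumes r: "0 < \<rho>" "\<rho> \<le> r" and s: "\<bar>s\<bar> = \<nu>" and l: "0 \<le> l" and EB: "exp (l * r * cos \<theta>) \<le> B"
    and \<xi>: "norm \<xi> \<le> M"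
  shows "exp (s * \<theta>) * (- (\<nu> * M * B / \<rho>) - l * M * exp (l * r * cos \<theta>)) \<le> barrier_D1 B l s r \<theta> \<xi>"
proof -
  define E where "E = exp (l * r * cos \<theta>)"
  have E: "0 < E" "E \<le> B" using EB by (auto simp: E_def)
  have M: "0 \<le> M" using \<xi> norm_ge_zero order_trans by blast
  have "(tangential_part \<theta> \<xi>)\<^sup>2 \<le> (norm \<xi>)\<^sup>2"
    using norm_sq_frame[of \<theta> \<xi>] zero_le_power2[of "radial_part \<theta> \<xi>"] by linarith
  then have "\<bar>tangential_part \<theta> \<xi>\<bar> \<le> norm \<xi>"
    unfolding abs_le_square_iff[symmetric] by simp
  then have a: "\<bar>tangential_part \<theta> \<xi> / r\<bar> \<le> M / \<rho>"
    using r \<xi> M by (auto simp: abs_divide intro!: frac_le)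
  have "\<bar>s * tangential_part \<theta> \<xi> / r * (B - E)\<bar> = \<nu> * \<bar>tangential_part \<theta> \<xi> / r\<bar> * (B - E)"
    using E s by (simp add: abs_mult abs_divide)
  also have "\<dots> \<le> \<nu> * (M / \<rho>) * B"
    using a s E M r by (intro mult_mono mult_left_mono) auto
  finally have "\<bar>s * tangential_part \<theta> \<xi> / r * (B - E)\<bar> \<le> \<nu> * M * B / \<rho>" by simp
  then have 1: "- (\<nu> * M * B / \<rho>) \<le> s * tangential_part \<theta> \<xi> / r * (B - E)"
    by (metis abs_le_D2 minus_le_iff)
  have "\<bar>\<xi>$1\<bar> \<le> M" using component_le_norm_cart[of \<xi> 1] \<xi> by simp
  then have 2: "l * \<xi>$1 * E \<le> l * M * E" using l E by (intro mult_right_mono mult_left_mono) auto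
  show ?thesis
    unfolding barrier_D1_def Let_def E_def[symmetric] using 1 2 by (intro mult_left_mono) auto
qed

lemma barrier_D2_le:
  assumes r: "0 < \<rho>" "\<rho> \<le> r" and s: "\<bar>s\<bar> = \<nu>" "\<nu> \<le> 1" and l: "0 \<le> l"
    and EB: "exp (l * r * cos \<theta>) \<le> B"
  shows "barrier_D2 B l s r \<theta> \<xi> \<le> exp (s * \<theta>) *
    (\<nu> * (norm \<xi>)\<^sup>2 * (2 * B / \<rho>\<^sup>2 + 2 * l * B / \<rho>) - l\<^sup>2 * (\<xi>$1)\<^sup>2 * exp (l * r * cos \<theta>))"
proof -
  define E where "E = exp (l * r * cos \<theta>)"
  define n where "n = norm \<xi>"
  define a where "a = tangential_part \<theta> \<xi> / r"
  define p where "p = radial_part \<theta> \<xi> / r"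
  have E: "0 < E" "E \<le> B" using EB by (auto simp: E_def)
  have \<nu>: "0 \<le> \<nu>" using s by auto
  have "a\<^sup>2 + p\<^sup>2 = n\<^sup>2 / r\<^sup>2"
    unfolding a_def p_def n_def by (simp add: norm_sq_frame[symmetric, of _ \<theta>] power_divide add_divide_distrib)
  also have "\<dots> \<le> n\<^sup>2 / \<rho>\<^sup>2" using r by (intro divide_left_mono power_mono) auto
  finally have ap: "a\<^sup>2 + p\<^sup>2 \<le> (n / \<rho>)\<^sup>2" by (simp add: power_divide)
  have a2: "a\<^sup>2 \<le> (n / \<rho>)\<^sup>2" using ap zero_le_power2[of p] by linarith
  then have a: "\<bar>a\<bar> \<le> n / \<rho>"
    using r unfolding abs_le_square_iff[symmetric] by (simp add: n_def)
  have "\<bar>2 * a * p\<bar> \<le> a\<^sup>2 + p\<^sup>2"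
    using sum_squares_bound[of "\<bar>a\<bar>" "\<bar>p\<bar>"] by (simp add: abs_mult)
  with ap have ap2: "\<bar>2 * a * p\<bar> \<le> (n / \<rho>)\<^sup>2" by linarith
  have "s\<^sup>2 \<le> \<nu>"
    using s \<nu> by (metis abs_ge_zero mult_left_le power2_abs power2_eq_square)
  then have "s\<^sup>2 * a\<^sup>2 \<le> \<nu> * (n / \<rho>)\<^sup>2"
    using a2 \<nu> by (intro mult_mono) auto
  moreover have "\<bar>s * (2 * a * p)\<bar> \<le> \<nu> * (n / \<rho>)\<^sup>2"
    unfolding abs_mult[of s] using s ap2 \<nu> by (simp add: mult_left_mono)
  ultimately have "s\<^sup>2 * a\<^sup>2 - 2 * s * a * p \<le> 2 * \<nu> * (n / \<rho>)\<^sup>2" by (simp add: algebra_simps)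
  then have "(s\<^sup>2 * a\<^sup>2 - 2 * s * a * p) * (B - E) \<le> 2 * \<nu> * (n / \<rho>)\<^sup>2 * (B - E)"
    using E by (intro mult_right_mono) auto
  also have "\<dots> \<le> 2 * \<nu> * (n / \<rho>)\<^sup>2 * B"
    using E \<nu> by (intro mult_left_mono) auto
  finally have 1: "(s\<^sup>2 * a\<^sup>2 - 2 * s * a * p) * (B - E) \<le> \<nu> * n\<^sup>2 * (2 * B / \<rho>\<^sup>2)"
    by (simp add: power_divide mult_ac)
  have x: "\<bar>\<xi>$1\<bar> \<le> n" using component_le_norm_cart[of \<xi> 1] by (simp add: n_def)
  have "\<bar>2 * s * a * l * \<xi>$1 * E\<bar> = 2 * \<nu> * l * (\<bar>a\<bar> * \<bar>\<xi>$1\<bar> * E)"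
    using E s l by (simp add: abs_mult)
  also have "\<dots> \<le> 2 * \<nu> * l * ((n / \<rho>) * n * B)"
    using a x E \<nu> l r by (intro mult_left_mono mult_mono) (auto simp: n_def)
  finally have 2: "- (2 * s * a * l * \<xi>$1 * E) \<le> \<nu> * n\<^sup>2 * (2 * l * B / \<rho>)"
    by (simp add: power2_eq_square mult_ac)
  show ?thesis
    unfolding barrier_D2_def Let_def E_def[symmetric] n_def[symmetric] a_def[symmetric]
    using 1 2 by (intro mult_left_mono) (auto simp: p_def algebra_simps)
qed

section \<open>The strict supersolution on the spiral\<close>

text \<open>The lower bound \<open>\<rho>\<close> on the radii controls the derivatives of the angle, and
  the upper bound \<open>R\<close> controls the exponential profile.\<close>

locale elliptic_spiral =
  fixes \<theta>0 \<rho> R c0 M1 M2 :: real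
    and r1 r2 :: "real \<Rightarrow> real"
    and A :: "real^2 \<Rightarrow> real^2^2"
    and b :: "real^2 \<Rightarrow> real^2"
  assumes r1_cont: "continuous_on {\<theta>0..} r1"
    and r2_cont: "continuous_on {\<theta>0..} r2"
    and \<rho>_pos: "0 < \<rho>"
    and \<rho>_le: "\<And>\<theta>. \<theta>0 \<le> \<theta> \<Longrightarrow> \<rho> \<le> r1 \<theta>"
    and r1_less_r2: "\<And>\<theta>. \<theta>0 \<le> \<theta> \<Longrightarrow> r1 \<theta> < r2 \<theta>"
    and r2_le: "\<And>\<theta>. \<theta>0 \<le> \<theta> \<Longrightarrow> r2 \<theta> \<le> R"
    and symmetric: "\<And>x. x \<in> spiral_open \<theta>0 r1 r2 \<Longrightarrow> transpose (A x) = A x"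
    and c0_pos: "0 < c0" and M1_pos: "0 < M1" and M2_nonneg: "0 \<le> M2"
    and elliptic: "\<And>x \<xi>. x \<in> spiral_open \<theta>0 r1 r2 \<Longrightarrow> c0 * (norm \<xi>)\<^sup>2 \<le> \<xi> \<bullet> (A x *v \<xi>)"
    and trace_le: "\<And>x. x \<in> spiral_open \<theta>0 r1 r2 \<Longrightarrow> trace (A x) \<le> M1"
    and drift_le: "\<And>x. x \<in> spiral_open \<theta>0 r1 r2 \<Longrightarrow> norm (b x) \<le> M2"
begin

text \<open>The steepness satisfies \<open>lam * c0 = M2 + 1\<close>, so the profile contributes at least
  \<open>lam * exp (lam * x$1) \<ge> lam / m\<close> to the operator. The angular terms contribute at most \<open>\<nu> * Q\<close>, and
  the choice of \<open>\<nu>\<close> makes this at most half of the former; \<open>\<nu> \<le> 1\<close> serves to replace \<open>\<nu>\<^sup>2\<close> by \<open>\<nu>\<close>.\<close>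

definition lam :: real where "lam = (M2 + 1) / c0"
definition m :: real where "m = exp (lam * R)"
definition Q :: real where
  "Q = M1 * (2 * (2 * m) / \<rho>\<^sup>2 + 2 * lam * (2 * m) / \<rho>) + M2 * (2 * m) / \<rho>"
definition \<nu> :: real where "\<nu> = min 1 (lam / (2 * m * Q))"

abbreviation w :: "real \<Rightarrow> real^2 \<Rightarrow> real \<Rightarrow> real" where "w \<equiv> barrier (2 * m) lam"

lemma lam_pos: "0 < lam" and m_pos: "0 < m" and Q_pos: "0 < Q"
proof -
  show lam: "0 < lam" using c0_pos M2_nonneg by (simp add: lam_def)
  show m: "0 < m" by (simp add: m_def)
  have "0 < M1 * (2 * (2 * m) / \<rho>\<^sup>2 + 2 * lam * (2 * m) / \<rho>)"
    using \<rho>_pos M1_pos lam m by (intro mult_pos_pos add_pos_pos divide_pos_pos) auto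
  moreover have "0 \<le> M2 * (2 * m) / \<rho>" using \<rho>_pos M2_nonneg m by simp
  ultimately show "0 < Q" by (simp add: Q_def)
qed

lemma \<nu>_pos: "0 < \<nu>" and \<nu>_le_1: "\<nu> \<le> 1" and \<nu>_small: "\<nu> * Q < lam / m"
proof -
  show "0 < \<nu>" using lam_pos m_pos Q_pos by (simp add: \<nu>_def)
  show "\<nu> \<le> 1" by (simp add: \<nu>_def)
  have "\<nu> * Q \<le> lam / (2 * m * Q) * Q"
    using Q_pos by (intro mult_right_mono) (auto simp: \<nu>_def)
  also have "\<dots> < lam / m" using Q_pos lam_pos m_pos by (simp add: field_simps)
  finally show "\<nu> * Q < lam / m" .
qed

lemma abs_radius_le:
  assumes "\<theta>0 \<le> \<theta>" "r1 \<theta> \<le> r" "r \<le> r2 \<theta>"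
  shows "\<bar>r * cos \<theta>\<bar> \<le> R"
proof -
  have "0 < r" "r \<le> R" using assms \<rho>_pos \<rho>_le[of \<theta>] r2_le[of \<theta>] by auto
  then show ?thesis
    using abs_cos_le_one[of \<theta>] mult_mono[of "\<bar>r\<bar>" R "\<bar>cos \<theta>\<bar>" 1] by (simp add: abs_mult)
qed

lemma exp_bounds:
  assumes "\<theta>0 \<le> \<theta>" "r1 \<theta> \<le> r" "r \<le> r2 \<theta>"
  shows "1 / m \<le> exp (lam * (r * cos \<theta>))" "exp (lam * (r * cos \<theta>)) \<le> m"
proof -
  have "\<bar>lam * (r * cos \<theta>)\<bar> \<le> lam * R"
    using mult_left_mono[OF abs_radius_le[OF assms], of lam] lam_pos by (simp add: abs_mult)
  then have "- (lam * R) \<le> lam * (r * cos \<theta>)" "lam * (r * cos \<theta>) \<le> lam * R" by auto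
  then show "1 / m \<le> exp (lam * (r * cos \<theta>))" "exp (lam * (r * cos \<theta>)) \<le> m"
    by (simp_all add: m_def inverse_eq_divide[symmetric] flip: exp_minus)
qed

lemma w_bounds:
  assumes "\<theta>0 \<le> \<theta>" "r1 \<theta> \<le> r" "r \<le> r2 \<theta>"
  shows "exp (s * \<theta>) * m \<le> w s (polar r \<theta>) \<theta>" "w s (polar r \<theta>) \<theta> \<le> exp (s * \<theta>) * (2 * m)"
  using exp_bounds[OF assms] by (auto simp: barrier_def)

lemma polar_in_U:
  "\<theta>0 < \<theta> \<Longrightarrow> r1 \<theta> < r \<Longrightarrow> r < r2 \<theta> \<Longrightarrow> polar r \<theta> \<in> spiral_open \<theta>0 r1 r2"
  by (auto simp: spiral_open_def)

text \<open>The coordinate \<open>x$1\<close> works as a profile since ellipticity bounds the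
  coefficient \<open>A\<^sub>1\<^sub>1 = p\<^sub>1\<^sup>2 + q\<^sub>1\<^sup>2\<close> of its second derivative from below by \<open>c0\<close>, while the trace
  \<open>|p|\<^sup>2 + |q|\<^sup>2\<close> bounds the angular terms.\<close>

lemma barrier_strict_supersolution:
  assumes s: "\<bar>s\<bar> = \<nu>" and \<theta>: "\<theta>0 < \<theta>" and r: "r1 \<theta> < r" "r < r2 \<theta>"
    and A: "\<And>i j. A (polar r \<theta>) $ i $ j = p $ i * p $ j + q $ i * q $ j"
  shows "barrier_D2 (2 * m) lam s r \<theta> p + barrier_D2 (2 * m) lam s r \<theta> q
    < barrier_D1 (2 * m) lam s r \<theta> (b (polar r \<theta>))"
proof -
  let ?x = "polar r \<theta>"
  note U = polar_in_U[OF \<theta> r]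
  define E where "E = exp (lam * r * cos \<theta>)"
  have E: "1 / m \<le> E" "E \<le> 2 * m"
    using exp_bounds[of \<theta> r] \<theta> r m_pos by (auto simp: E_def mult.assoc)
  have \<rho>: "\<rho> \<le> r" using \<rho>_le[of \<theta>] \<theta> r by simp
  have tr: "(norm p)\<^sup>2 + (norm q)\<^sup>2 \<le> M1"
    using trace_le[OF U] unfolding norm_sq_real2 by (simp add: trace_def sum_2 A power2_eq_square)
  have "c0 * (norm (axis 1 1 :: real^2))\<^sup>2 \<le> axis 1 1 \<bullet> (A ?x *v axis 1 1)"
    by (rule elliptic[OF U])
  then have c: "c0 \<le> (p$1)\<^sup>2 + (q$1)\<^sup>2"
    unfolding inner_axis' norm_axis_1
    by (simp add: matrix_vector_mult_def sum_2 axis_def A power2_eq_square)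
  define K where "K = 2 * (2 * m) / \<rho>\<^sup>2 + 2 * lam * (2 * m) / \<rho>"
  have K: "0 \<le> K" using \<rho>_pos lam_pos m_pos by (simp add: K_def)
  have D2: "barrier_D2 (2 * m) lam s r \<theta> \<xi> \<le> exp (s * \<theta>) *
      (\<nu> * (norm \<xi>)\<^sup>2 * K - lam\<^sup>2 * (\<xi>$1)\<^sup>2 * E)" for \<xi>
    unfolding K_def E_def
    by (rule barrier_D2_le[OF \<rho>_pos \<rho> s \<nu>_le_1]) (use lam_pos E in \<open>auto simp: E_def\<close>)
  have D1: "exp (s * \<theta>) * (- (\<nu> * M2 * (2 * m) / \<rho>) - lam * M2 * E)
      \<le> barrier_D1 (2 * m) lam s r \<theta> (b ?x)"
    unfolding E_def
    by (rule barrier_D1_ge[OF \<rho>_pos \<rho> s]) (use lam_pos E drift_le[OF U] in \<open>auto simp: E_def\<close>)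
  have "\<nu> * ((norm p)\<^sup>2 + (norm q)\<^sup>2) * K \<le> \<nu> * M1 * K"
    using tr \<nu>_pos K by (intro mult_right_mono mult_left_mono) auto
  moreover have "lam\<^sup>2 * c0 * E \<le> lam\<^sup>2 * ((p$1)\<^sup>2 + (q$1)\<^sup>2) * E"
    using c by (intro mult_right_mono mult_left_mono) (auto simp: E_def)
  moreover have "lam\<^sup>2 * c0 * E = lam * M2 * E + lam * E"
  proof -
    have "lam * c0 = M2 + 1" using c0_pos by (simp add: lam_def)
    then show ?thesis by algebra
  qed
  moreover have "lam * (1 / m) \<le> lam * E"
    using E lam_pos by (intro mult_left_mono) auto
  moreover have "\<nu> * M1 * K + \<nu> * M2 * (2 * m) / \<rho> < lam * (1 / m)"
    using \<nu>_small by (simp add: Q_def K_def algebra_simps)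
  ultimately have "(\<nu> * (norm p)\<^sup>2 * K - lam\<^sup>2 * (p$1)\<^sup>2 * E)
      + (\<nu> * (norm q)\<^sup>2 * K - lam\<^sup>2 * (q$1)\<^sup>2 * E) < - (\<nu> * M2 * (2 * m) / \<rho>) - lam * M2 * E"
    by (simp add: algebra_simps)
  then have "exp (s * \<theta>) * ((\<nu> * (norm p)\<^sup>2 * K - lam\<^sup>2 * (p$1)\<^sup>2 * E)
      + (\<nu> * (norm q)\<^sup>2 * K - lam\<^sup>2 * (q$1)\<^sup>2 * E)) <
      exp (s * \<theta>) * (- (\<nu> * M2 * (2 * m) / \<rho>) - lam * M2 * E)"
    by (intro mult_strict_left_mono) auto
  then show ?thesis using D1 D2[of p] D2[of q] by (simp add: distrib_left)
qed

section \<open>The comparison principle\<close>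

text \<open>Maxima will be taken over a rectangle of polar
  coordinates. This lemma transfers them to the plane: a short segment around an interior point runs
  inside the strip, with the angle given by the local branch.\<close>

lemma eventually_line_in_strip:
  assumes T: "\<theta>0 \<le> T1" "T1 < \<theta>" "\<theta> < T2" and r: "r1 \<theta> < r" "r < r2 \<theta>"
  shows "\<forall>\<^sub>F t in nhds 0. \<exists>r'. polar r \<theta> + t *\<^sub>R \<xi> = polar r' (line_angle r \<theta> \<xi> t) \<and>
    T1 < line_angle r \<theta> \<xi> t \<and> line_angle r \<theta> \<xi> t < T2 \<and>
    r1 (line_angle r \<theta> \<xi> t) < r' \<and> r' < r2 (line_angle r \<theta> \<xi> t)"
proof -
  let ?a = "line_angle r \<theta> \<xi>" and ?n = "\<lambda>t. norm (polar r \<theta> + t *\<^sub>R \<xi>)"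
  have r0: "0 < r" using r \<rho>_pos \<rho>_le[of \<theta>] T by simp
  have "(?a \<longlongrightarrow> \<theta> + arctan (0 * tangential_part \<theta> \<xi> / (r + 0 * radial_part \<theta> \<xi>))) (nhds 0)"
    unfolding line_angle_def by (intro tendsto_intros filterlim_ident) (use r0 in simp)
  then have a: "(?a \<longlongrightarrow> \<theta>) (nhds 0)" by simp
  have n0: "norm (polar r \<theta>) = r"
  proof -
    have "(norm (polar r \<theta>))\<^sup>2 = r\<^sup>2 * ((sin \<theta>)\<^sup>2 + (cos \<theta>)\<^sup>2)"
      unfolding norm_sq_real2 polar_nth by algebra
    then show ?thesis using r0 by (simp add: power2_eq_iff_nonneg)
  qed
  have "(?n \<longlongrightarrow> norm (polar r \<theta> + 0 *\<^sub>R \<xi>)) (nhds 0)"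
    by (intro tendsto_intros filterlim_ident)
  then have n: "(?n \<longlongrightarrow> r) (nhds 0)" by (simp add: n0)
  have c: "isCont r1 \<theta>" "isCont r2 \<theta>"
    using r1_cont r2_cont T by (auto intro: continuous_on_interior)
  have "((\<lambda>t. ?n t - r1 (?a t)) \<longlongrightarrow> r - r1 \<theta>) (nhds 0)"
    "((\<lambda>t. r2 (?a t) - ?n t) \<longlongrightarrow> r2 \<theta> - r) (nhds 0)"
    by (intro tendsto_diff n isCont_tendsto_compose[OF c(1) a] isCont_tendsto_compose[OF c(2) a])+
  then have "\<forall>\<^sub>F t in nhds 0. 0 < ?n t - r1 (?a t)" "\<forall>\<^sub>F t in nhds 0. 0 < r2 (?a t) - ?n t"
    using r by (auto dest!: order_tendstoD(1)[where a=0])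
  moreover have "\<forall>\<^sub>F t in nhds 0. T1 < ?a t" "\<forall>\<^sub>F t in nhds 0. ?a t < T2"
    using order_tendstoD[OF a] T by auto
  ultimately show ?thesis
    using eventually_line_in_front[OF r0, of \<theta> \<xi>]
  proof eventually_elim
    case (elim t)
    then show ?case using line_polar_coordinates[of r t \<theta> \<xi>] by (intro exI[of _ "?n t"]) auto
  qed
qed

text \<open>At an interior maximum the derivatives of \<open>\<kappa> * u\<close> along the lines in
  directions \<open>p\<close>, \<open>q\<close> and \<open>b\<close> are compared with those of the barrier. Adding them up, with the signs of \<open>L\<close>, gives
  \<open>0 = \<kappa> * L u \<ge> L w > 0\<close> for the combination \<open>w\<close> of the two barriers.
  The factor \<open>\<kappa>\<close>, to be used with \<open>1\<close> and \<open>- 1\<close>, treats \<open>u\<close> and \<open>- u\<close> at once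
  without partial derivatives of \<open>- u\<close>.\<close>

lemma no_interior_maximum:
  assumes u: "C2_on (spiral_open \<theta>0 r1 r2) u" and eq: "elliptic_op A b u (polar r \<theta>) = 0"
    and T: "\<theta>0 \<le> T1" "T1 < \<theta>" "\<theta> < T2" and r: "r1 \<theta> < r" "r < r2 \<theta>"
    and \<delta>: "0 \<le> \<delta>" and \<epsilon>: "0 < \<epsilon>"
    and max: "\<And>r' \<theta>'. T1 < \<theta>' \<Longrightarrow> \<theta>' < T2 \<Longrightarrow> r1 \<theta>' < r' \<Longrightarrow> r' < r2 \<theta>' \<Longrightarrow>
      \<kappa> * u (polar r' \<theta>') - (\<delta> * w (- \<nu>) (polar r' \<theta>') \<theta>' + \<epsilon> * w \<nu> (polar r' \<theta>') \<theta>')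
      \<le> \<kappa> * u (polar r \<theta>) - (\<delta> * w (- \<nu>) (polar r \<theta>) \<theta> + \<epsilon> * w \<nu> (polar r \<theta>) \<theta>)"
  shows False
proof -
  let ?x = "polar r \<theta>" and ?U = "spiral_open \<theta>0 r1 r2"
  let ?D1 = "\<lambda>s. barrier_D1 (2 * m) lam s r \<theta>" and ?D2 = "\<lambda>s. barrier_D2 (2 * m) lam s r \<theta>"
  have \<theta>: "\<theta>0 < \<theta>" using T by simp
  have r0: "0 < r" using r \<rho>_pos \<rho>_le[of \<theta>] \<theta> by simp
  note U = polar_in_U[OF \<theta> r]
  have test: "\<kappa> * (\<Sum>i\<in>UNIV. \<xi>$i * partial_deriv i u ?x) = \<delta> * ?D1 (-\<nu>) \<xi> + \<epsilon> * ?D1 \<nu> \<xi>"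
    "\<kappa> * (\<Sum>i\<in>UNIV. \<Sum>j\<in>UNIV. \<xi>$i * \<xi>$j * partial_deriv i (partial_deriv j u) ?x)
      \<le> \<delta> * ?D2 (-\<nu>) \<xi> + \<epsilon> * ?D2 \<nu> \<xi>" for \<xi>
  proof -
    let ?a = "line_angle r \<theta> \<xi>" and ?y = "\<lambda>t. ?x + t *\<^sub>R \<xi>"
    obtain v1 where v1: "\<forall>\<^sub>F t in nhds 0. ((\<lambda>t. w (-\<nu>) (?y t) (?a t)) has_real_derivative v1 t) (at t)"
      "v1 0 = ?D1 (-\<nu>) \<xi>" "(v1 has_real_derivative ?D2 (-\<nu>) \<xi>) (at 0)"
      using barrier_along_line[OF r0] by blast
    obtain v2 where v2: "\<forall>\<^sub>F t in nhds 0. ((\<lambda>t. w \<nu> (?y t) (?a t)) has_real_derivative v2 t) (at t)"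
      "v2 0 = ?D1 \<nu> \<xi>" "(v2 has_real_derivative ?D2 \<nu> \<xi>) (at 0)"
      using barrier_along_line[OF r0] by blast
    let ?f = "\<lambda>t. \<kappa> * u (?y t) - (\<delta> * w (-\<nu>) (?y t) (?a t) + \<epsilon> * w \<nu> (?y t) (?a t))"
    let ?f' = "\<lambda>t. \<kappa> * (\<Sum>i\<in>UNIV. \<xi>$i * partial_deriv i u (?y t)) - (\<delta> * v1 t + \<epsilon> * v2 t)"
    note strip = eventually_line_in_strip[OF T r, of \<xi>]
    have a0: "?a 0 = \<theta>" by (simp add: line_angle_def)
    have f': "\<forall>\<^sub>F t in nhds 0. (?f has_real_derivative ?f' t) (at t)"
      using strip v1(1) v2(1)
    proof eventually_elim
      case (elim t)
      have "?y t \<in> ?U" using elim(1) T(1) by (force simp: spiral_open_def)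
      then have "u differentiable (at (?y t))" using u by (auto simp: C2_on_def C1_on_def)
      from has_real_derivative_along_line[OF this] elim(2,3) show ?case
        by (intro DERIV_diff DERIV_add DERIV_cmult)
    qed
    have "partial_deriv i u differentiable (at ?x)" for i
      using u U by (auto simp: C2_on_def C1_on_def)
    from second_derivative_along_line[OF this] v1(3) v2(3)
    have f'': "(?f' has_real_derivative
        \<kappa> * (\<Sum>i\<in>UNIV. \<Sum>j\<in>UNIV. \<xi>$i * \<xi>$j * partial_deriv i (partial_deriv j u) ?x)
        - (\<delta> * ?D2 (-\<nu>) \<xi> + \<epsilon> * ?D2 \<nu> \<xi>)) (at 0)"
      by (intro DERIV_diff DERIV_add DERIV_cmult)
    have fmax: "\<forall>\<^sub>F t in nhds 0. ?f t \<le> ?f 0"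
      using strip
    proof eventually_elim
      case (elim t)
      then obtain r' where "?y t = polar r' (?a t)" "T1 < ?a t" "?a t < T2" "r1 (?a t) < r'" "r' < r2 (?a t)"
        by blast
      then show ?case using max[of "?a t" r'] by (simp add: a0)
    qed
    show "\<kappa> * (\<Sum>i\<in>UNIV. \<xi>$i * partial_deriv i u ?x) = \<delta> * ?D1 (-\<nu>) \<xi> + \<epsilon> * ?D1 \<nu> \<xi>"
      using second_derivative_test(1)[OF f' f'' fmax] v1(2) v2(2) by simp
    show "\<kappa> * (\<Sum>i\<in>UNIV. \<Sum>j\<in>UNIV. \<xi>$i * \<xi>$j * partial_deriv i (partial_deriv j u) ?x)
      \<le> \<delta> * ?D2 (-\<nu>) \<xi> + \<epsilon> * ?D2 \<nu> \<xi>"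
      using second_derivative_test(2)[OF f' f'' fmax] by simp
  qed
  obtain p q where pq: "\<And>i j. A ?x $ i $ j = p $ i * p $ j + q $ i * q $ j"
    using elliptic_matrix_sum_of_squares[OF symmetric[OF U] c0_pos elliptic[OF U]] by metis
  have L: "?D2 s p + ?D2 s q < ?D1 s (b ?x)" if "\<bar>s\<bar> = \<nu>" for s
    using barrier_strict_supersolution[OF that \<theta> r pq] .
  have "\<delta> * (?D2 (-\<nu>) p + ?D2 (-\<nu>) q) \<le> \<delta> * ?D1 (-\<nu>) (b ?x)"
    using L[of "-\<nu>"] \<delta> \<nu>_pos by (intro mult_left_mono) auto
  moreover have "\<epsilon> * (?D2 \<nu> p + ?D2 \<nu> q) < \<epsilon> * ?D1 \<nu> (b ?x)"
    using L[of \<nu>] \<epsilon> \<nu>_pos by (intro mult_strict_left_mono) auto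
  moreover have "\<kappa> * (\<Sum>i\<in>UNIV. \<Sum>j\<in>UNIV. A ?x $ i $ j * partial_deriv i (partial_deriv j u) ?x) =
      \<kappa> * (\<Sum>i\<in>UNIV. \<Sum>j\<in>UNIV. p$i * p$j * partial_deriv i (partial_deriv j u) ?x) +
      \<kappa> * (\<Sum>i\<in>UNIV. \<Sum>j\<in>UNIV. q$i * q$j * partial_deriv i (partial_deriv j u) ?x)"
    by (simp add: pq distrib_right sum.distrib distrib_left)
  moreover have "\<kappa> * (b ?x \<bullet> gradient u ?x) = \<kappa> * (\<Sum>i\<in>UNIV. b ?x $ i * partial_deriv i u ?x)"
    by (simp add: inner_vec_def gradient_def)
  moreover have "\<kappa> * elliptic_op A b u ?x = 0" using eq by simp
  ultimately show False
    using test(1)[of "b ?x"] test(2)[of p] test(2)[of q]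
    unfolding elliptic_op_def distrib_left minus_add_distrib mult_minus_right by linarith
qed

end

lemma continuous_on_polar:
  fixes f g :: "'a::t2_space \<Rightarrow> real"
  assumes "continuous_on S f" "continuous_on S g"
  shows "continuous_on S (\<lambda>z. polar (f z) (g z))"
proof -
  have "polar r \<theta> = (\<chi> i. if i = 1 then r * cos \<theta> else r * sin \<theta>)" for r \<theta>
    by (simp add: vec_eq_iff forall_2)
  moreover have "continuous_on S (\<lambda>z. if i = 1 then f z * cos (g z) else f z * sin (g z))" for i :: 2
    using continuous_on_mult[OF assms(1) continuous_on_cos[OF assms(2)]]
      continuous_on_mult[OF assms(1) continuous_on_sin[OF assms(2)]] by (cases "i = 1") auto
  ultimately show ?thesis by (simp add: continuous_on_vec_lambda)
qed

lemma below_exp_growth_eventually: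
  assumes "below_exp_growth r1 r2 u" "0 < s" "0 < c"
  shows "\<forall>\<^sub>F \<theta> in at_top. \<forall>x\<in>spiral_slice r1 r2 \<theta>. \<bar>u x\<bar> < c * exp (s * \<theta>)"
proof -
  let ?S = "\<lambda>\<theta>. SUP x\<in>spiral_slice r1 r2 \<theta>. ereal \<bar>u x\<bar>"
  have "((\<lambda>\<theta>. ereal (exp (- s * \<theta>)) * ?S \<theta>) \<longlongrightarrow> 0) at_top"
    using assms by (auto simp: below_exp_growth_def)
  then have "\<forall>\<^sub>F \<theta> in at_top. ereal (exp (- s * \<theta>)) * ?S \<theta> < ereal c"
    by (rule order_tendstoD) (use assms in simp)
  then show ?thesis
  proof (rule eventually_mono, intro ballI)
    fix \<theta> x assume *: "ereal (exp (- s * \<theta>)) * ?S \<theta> < ereal c" and x: "x \<in> spiral_slice r1 r2 \<theta>"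
    have "ereal (exp (- s * \<theta>)) * ereal \<bar>u x\<bar> \<le> ereal (exp (- s * \<theta>)) * ?S \<theta>"
      using x by (intro ereal_mult_left_mono SUP_upper) auto
    with * have "ereal (exp (- s * \<theta>)) * ereal \<bar>u x\<bar> < ereal c" by (rule le_less_trans[rotated])
    then show "\<bar>u x\<bar> < c * exp (s * \<theta>)" by (simp add: exp_minus field_simps)
  qed
qed

context elliptic_spiral
begin

text \<open>The rectangle of polar coordinates is cut off at an angle \<open>T\<close> beyond which the
  growing barrier exceeds \<open>\<kappa> * u\<close>. The maximum over it of \<open>\<kappa> * u\<close> minus the barriers then lies on one of the four
  sides, where it is at most \<open>K\<close>.\<close>

lemma comparison:
  assumes u: "C2_on (spiral_open \<theta>0 r1 r2) u" and cont: "continuous_on (spiral_full \<theta>0 r1 r2) u"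
    and growth: "below_exp_growth r1 r2 u"
    and eq: "\<And>x. x \<in> spiral_open \<theta>0 r1 r2 \<Longrightarrow> elliptic_op A b u x = 0"
    and \<theta>1: "\<theta>0 \<le> \<theta>1"
    and side1: "\<And>\<theta>. \<theta>1 \<le> \<theta> \<Longrightarrow> \<kappa> * u (polar (r1 \<theta>) \<theta>) \<le> K"
    and side2: "\<And>\<theta>. \<theta>1 \<le> \<theta> \<Longrightarrow> \<kappa> * u (polar (r2 \<theta>) \<theta>) \<le> K"
    and start: "\<And>x. x \<in> spiral_slice r1 r2 \<theta>1 \<Longrightarrow> \<kappa> * u x \<le> K'"
    and KK': "K \<le> K'"
    and \<theta>: "\<theta>1 \<le> \<theta>" and x: "x \<in> spiral_slice r1 r2 \<theta>"
  shows "\<kappa> * u x \<le> K + 2 * (K' - K) * exp (- \<nu> * (\<theta> - \<theta>1))"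
proof -
  define \<delta> where "\<delta> = (K' - K) * exp (\<nu> * \<theta>1) / m"
  have \<delta>: "0 \<le> \<delta>" using KK' m_pos by (simp add: \<delta>_def)
  obtain r where r: "r1 \<theta> \<le> r" "r \<le> r2 \<theta>" "x = polar r \<theta>" using x by (auto simp: spiral_slice_def)
  have below: "\<kappa> * u x - (\<delta> * w (-\<nu>) x \<theta> + \<epsilon> * w \<nu> x \<theta>) \<le> K" if \<epsilon>: "0 < \<epsilon>" for \<epsilon>
  proof -
    define G where "G = (\<lambda>r \<phi>. \<kappa> * u (polar r \<phi>) - (\<delta> * w (-\<nu>) (polar r \<phi>) \<phi> + \<epsilon> * w \<nu> (polar r \<phi>) \<phi>))"
    \<comment> \<open>Far out, both \<open>\<kappa> * u\<close> and \<open>\<bar>K\<bar>\<close> are to take up at most half of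
      \<open>\<epsilon> * w \<nu> \<ge> \<epsilon> * m * exp (\<nu> * \<theta>)\<close>.\<close>
    define c where "c = \<epsilon> * m / (2 * (\<bar>\<kappa>\<bar> + 1))"
    have c: "0 < c" using \<epsilon> m_pos by (simp add: c_def)
    have "\<forall>\<^sub>F T in at_top. \<bar>K\<bar> / (\<epsilon> * m / 2) \<le> exp (\<nu> * T)"
      using \<nu>_pos by real_asymp
    moreover note below_exp_growth_eventually[OF growth \<nu>_pos c]
    ultimately have "\<forall>\<^sub>F T in at_top. \<theta> < T \<and> \<bar>K\<bar> / (\<epsilon> * m / 2) \<le> exp (\<nu> * T) \<and>
        (\<forall>x\<in>spiral_slice r1 r2 T. \<bar>u x\<bar> < c * exp (\<nu> * T))"
      by (intro eventually_conj eventually_gt_at_top)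
    then obtain T where T: "\<theta> < T" "\<bar>K\<bar> / (\<epsilon> * m / 2) \<le> exp (\<nu> * T)"
      "\<And>x. x \<in> spiral_slice r1 r2 T \<Longrightarrow> \<bar>u x\<bar> < c * exp (\<nu> * T)"
      unfolding eventually_at_top_linorder by blast
    \<comment> \<open>Interpolating between the two radii maps a rectangle onto the truncated strip.\<close>
    define \<rho>' where "\<rho>' = (\<lambda>z::real \<times> real. (1 - fst z) * r1 (snd z) + fst z * r2 (snd z))"
    have \<rho>'_in: "r1 \<phi> \<le> \<rho>' (\<sigma>, \<phi>) \<and> \<rho>' (\<sigma>, \<phi>) \<le> r2 \<phi>" if "\<sigma> \<in> {0..1}" "\<theta>0 \<le> \<phi>" for \<sigma> \<phi>
    proof -
      have "0 \<le> \<sigma> * (r2 \<phi> - r1 \<phi>)" "0 \<le> (1 - \<sigma>) * (r2 \<phi> - r1 \<phi>)"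
        using that r1_less_r2[of \<phi>] by auto
      then show ?thesis by (simp add: \<rho>'_def algebra_simps)
    qed
    have onto: "\<exists>\<sigma>\<in>{0..1}. r = \<rho>' (\<sigma>, \<phi>)" if "\<theta>0 \<le> \<phi>" "r1 \<phi> \<le> r" "r \<le> r2 \<phi>" for r \<phi>
    proof (intro bexI)
      let ?\<sigma> = "(r - r1 \<phi>) / (r2 \<phi> - r1 \<phi>)"
      show "?\<sigma> \<in> {0..1}" using that r1_less_r2[of \<phi>] by simp
      have "?\<sigma> * (r2 \<phi> - r1 \<phi>) = r - r1 \<phi>" using that r1_less_r2[of \<phi>] by simp
      moreover have "\<rho>' (?\<sigma>, \<phi>) = r1 \<phi> + ?\<sigma> * (r2 \<phi> - r1 \<phi>)"
        unfolding \<rho>'_def fst_conv snd_conv by algebra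
      ultimately show "r = \<rho>' (?\<sigma>, \<phi>)" by simp
    qed
    let ?R = "{0..1::real} \<times> {\<theta>1..T}"
    have "continuous_on ?R (\<lambda>z. r1 (snd z))" "continuous_on ?R (\<lambda>z. r2 (snd z))"
      using \<theta>1 by (auto intro!: continuous_on_compose2[OF r1_cont] continuous_on_compose2[OF r2_cont] continuous_intros)
    then have "continuous_on ?R \<rho>'" unfolding \<rho>'_def by (intro continuous_intros)
    then have X: "continuous_on ?R (\<lambda>z. polar (\<rho>' z) (snd z))"
      by (intro continuous_on_polar continuous_intros)
    have "continuous_on ?R (\<lambda>z. u (polar (\<rho>' z) (snd z)))"
      by (rule continuous_on_compose2[OF cont X])
        (use \<rho>'_in \<theta>1 in \<open>force simp: spiral_full_def\<close>)
    then have "continuous_on ?R (\<lambda>z. G (\<rho>' z) (snd z))"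
      unfolding G_def barrier_def by (intro continuous_intros X)
    moreover have "compact ?R" "?R \<noteq> {}" using T \<theta> by (auto intro!: compact_Times)
    ultimately obtain z where zR: "z \<in> ?R"
      and zmax: "\<And>z'. z' \<in> ?R \<Longrightarrow> G (\<rho>' z') (snd z') \<le> G (\<rho>' z) (snd z)"
      using continuous_attains_sup[of ?R "\<lambda>z. G (\<rho>' z) (snd z)"] by blast
    obtain \<sigma> \<phi> where z_eq: "z = (\<sigma>, \<phi>)" by (cases z)
    have z: "\<sigma> \<in> {0..1}" "\<phi> \<in> {\<theta>1..T}" using zR by (simp_all add: z_eq)
    have Gmax: "G (\<rho>' (\<sigma>', \<phi>')) \<phi>' \<le> G (\<rho>' (\<sigma>, \<phi>)) \<phi>"
      if "\<sigma>' \<in> {0..1}" "\<phi>' \<in> {\<theta>1..T}" for \<sigma>' \<phi>'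
      using zmax[of "(\<sigma>', \<phi>')"] that by (simp add: z_eq)
    define s where "s = \<rho>' (\<sigma>, \<phi>)"
    have \<phi>0: "\<theta>0 \<le> \<phi>" using z \<theta>1 by auto
    have s: "r1 \<phi> \<le> s" "s \<le> r2 \<phi>" using \<rho>'_in z \<phi>0 by (auto simp: s_def)
    have max: "G r' \<phi>' \<le> G s \<phi>" if "\<phi>' \<in> {\<theta>1..T}" "r1 \<phi>' \<le> r'" "r' \<le> r2 \<phi>'" for r' \<phi>'
      using onto[of \<phi>' r'] that Gmax[of _ \<phi>'] \<theta>1 by (auto simp: s_def)
    note wb = w_bounds(1)[OF \<phi>0 s]
    have w1: "0 \<le> \<delta> * w (-\<nu>) (polar s \<phi>) \<phi>" and w2: "0 \<le> \<epsilon> * w \<nu> (polar s \<phi>) \<phi>"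
      using \<delta> \<epsilon> m_pos by (auto intro!: mult_nonneg_nonneg order_trans[OF _ wb])
    have "G s \<phi> \<le> K"
    proof -
      consider "s = r1 \<phi>" | "s = r2 \<phi>" | "\<phi> = \<theta>1" | "\<phi> = T"
        | "r1 \<phi> < s" "s < r2 \<phi>" "\<theta>1 < \<phi>" "\<phi> < T"
        using s z by force
      then show ?thesis
      proof cases
        case 1
        then show ?thesis using side1[of \<phi>] z w1 w2 by (simp add: G_def)
      next
        case 2
        then show ?thesis using side2[of \<phi>] z w1 w2 by (simp add: G_def)
      next
        case 3
        have "\<kappa> * u (polar s \<phi>) \<le> K'" using 3 s by (intro start) (auto simp: spiral_slice_def)
        moreover have "K' - K \<le> \<delta> * w (-\<nu>) (polar s \<phi>) \<phi>"
        proof -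
          have "K' - K = \<delta> * (exp (-\<nu> * \<phi>) * m)" using 3 m_pos by (simp add: \<delta>_def exp_minus)
          also have "\<dots> \<le> \<delta> * w (-\<nu>) (polar s \<phi>) \<phi>" using \<delta> by (intro mult_left_mono wb)
          finally show ?thesis .
        qed
        ultimately show ?thesis using w2 by (simp add: G_def)
      next
        case 4
        have "\<bar>u (polar s \<phi>)\<bar> < c * exp (\<nu> * T)"
          using 4 s by (intro T) (auto simp: spiral_slice_def)
        then have "\<bar>\<kappa>\<bar> * \<bar>u (polar s \<phi>)\<bar> \<le> (\<bar>\<kappa>\<bar> + 1) * (c * exp (\<nu> * T))"
          by (intro mult_mono) auto
        also have "\<dots> = \<epsilon> * m / 2 * exp (\<nu> * T)" by (simp add: c_def field_simps)
        finally have "\<kappa> * u (polar s \<phi>) \<le> \<epsilon> * m / 2 * exp (\<nu> * T)"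
          by (simp flip: abs_mult)
        moreover have "\<bar>K\<bar> \<le> \<epsilon> * m / 2 * exp (\<nu> * T)"
          using T(2) \<epsilon> m_pos by (simp add: field_simps)
        moreover have "\<epsilon> * (exp (\<nu> * T) * m) \<le> \<epsilon> * w \<nu> (polar s \<phi>) \<phi>"
          using \<epsilon> wb[of \<nu>] 4 by (intro mult_left_mono) auto
        ultimately show ?thesis using w1 by (simp add: G_def algebra_simps)
      next
        case 5
        have U: "polar s \<phi> \<in> spiral_open \<theta>0 r1 r2" using 5 \<theta>1 by (intro polar_in_U) auto
        have False
          by (rule no_interior_maximum[OF u eq[OF U] \<theta>1 5(3,4,1,2) \<delta> \<epsilon>, where \<kappa> = \<kappa>])
            (use max in \<open>simp add: G_def\<close>)
        then show ?thesis ..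
      qed
    qed
    moreover have "G r \<theta> \<le> G s \<phi>" using T \<theta> r by (intro max) auto
    ultimately show ?thesis by (simp add: G_def r)
  qed
  have W: "w s x \<theta> \<le> exp (s * \<theta>) * (2 * m)" for s
    using w_bounds(2)[of \<theta> r s] r \<theta> \<theta>1 by simp
  have "\<kappa> * u x \<le> K + \<delta> * w (-\<nu>) x \<theta> + e" if "0 < e" for e
  proof -
    define \<epsilon> where "\<epsilon> = e / (exp (\<nu> * \<theta>) * (2 * m))"
    have \<epsilon>: "0 < \<epsilon>" using that m_pos by (simp add: \<epsilon>_def)
    have "\<epsilon> * w \<nu> x \<theta> \<le> \<epsilon> * (exp (\<nu> * \<theta>) * (2 * m))" using \<epsilon> W by (intro mult_left_mono) auto
    also have "\<dots> = e" using m_pos by (simp add: \<epsilon>_def)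
    finally show ?thesis using below[OF \<epsilon>] by linarith
  qed
  then have "\<kappa> * u x \<le> K + \<delta> * w (-\<nu>) x \<theta>" by (rule field_le_epsilon)
  also have "\<dots> \<le> K + \<delta> * (exp (-\<nu> * \<theta>) * (2 * m))" using \<delta> W[of "-\<nu>"] by (intro add_left_mono mult_left_mono) auto
  also have "\<delta> * (exp (-\<nu> * \<theta>) * (2 * m)) = 2 * (K' - K) * exp (- \<nu> * (\<theta> - \<theta>1))"
  proof -
    have "exp (- \<nu> * (\<theta> - \<theta>1)) = exp (\<nu> * \<theta>1) * exp (- \<nu> * \<theta>)"
      by (simp add: algebra_simps flip: exp_add)
    then show ?thesis using m_pos by (simp add: \<delta>_def)
  qed
  finally show ?thesis by simp
qed

end

section \<open>Oscillation estimates\<close>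

lemma osc_le:
  assumes "K \<noteq> {}" "\<And>x. x \<in> K \<Longrightarrow> lo \<le> u x" "\<And>x. x \<in> K \<Longrightarrow> u x \<le> hi"
  shows "osc u K \<le> ereal (hi - lo)"
proof -
  have "osc u K \<le> ereal hi - ereal lo"
    unfolding osc_def using assms by (intro ereal_minus_mono SUP_least INF_greatest) auto
  then show ?thesis by simp
qed

lemma osc_eq:
  assumes "K \<noteq> {}" "bounded (u ` K)"
  shows "osc u K = ereal (Sup (u ` K) - Inf (u ` K))"
proof -
  obtain B where B: "\<And>x. x \<in> K \<Longrightarrow> \<bar>u x\<bar> \<le> B"
    using assms(2) by (auto simp: bounded_iff)
  obtain x where x: "x \<in> K" using assms(1) by blast
  have "(SUP x\<in>K. ereal (u x)) \<le> ereal B" "ereal (u x) \<le> (SUP x\<in>K. ereal (u x))"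
    "ereal (- B) \<le> (INF x\<in>K. ereal (u x))" "(INF x\<in>K. ereal (u x)) \<le> ereal (u x)"
    using B x by (auto intro!: SUP_least SUP_upper INF_greatest INF_lower simp: abs_le_iff)
       (smt (verit) B)+
  then have "\<bar>SUP x\<in>K. ereal (u x)\<bar> \<noteq> \<infinity>" "\<bar>INF x\<in>K. ereal (u x)\<bar> \<noteq> \<infinity>" by auto
  then have "(SUP x\<in>K. ereal (u x)) = ereal (Sup (u ` K))" "(INF x\<in>K. ereal (u x)) = ereal (Inf (u ` K))"
    using ereal_Sup[of "u ` K"] ereal_Inf[of "u ` K"] by (simp_all add: image_image)
  then show ?thesis by (simp add: osc_def)
qed

context elliptic_spiral
begin

lemma two_sided_decay:
  assumes u: "C2_on (spiral_open \<theta>0 r1 r2) u" "continuous_on (spiral_full \<theta>0 r1 r2) u"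
      "below_exp_growth r1 r2 u" "\<And>x. x \<in> spiral_open \<theta>0 r1 r2 \<Longrightarrow> elliptic_op A b u x = 0"
    and \<theta>1: "\<theta>0 \<le> \<theta>1"
    and side: "\<And>\<theta>. \<theta>1 \<le> \<theta> \<Longrightarrow> u (polar (r1 \<theta>) \<theta>) \<in> {k..K}" "\<And>\<theta>. \<theta>1 \<le> \<theta> \<Longrightarrow> u (polar (r2 \<theta>) \<theta>) \<in> {k..K}"
    and start: "\<And>x. x \<in> spiral_slice r1 r2 \<theta>1 \<Longrightarrow> u x \<in> {k'..K'}"
    and kK: "k' \<le> k" "K \<le> K'"
    and \<theta>: "\<theta>1 \<le> \<theta>" "x \<in> spiral_slice r1 r2 \<theta>"
  shows "u x \<in> {k - 2 * (k - k') * exp (- \<nu> * (\<theta> - \<theta>1)) .. K + 2 * (K' - K) * exp (- \<nu> * (\<theta> - \<theta>1))}"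
proof -
  have "1 * u x \<le> K + 2 * (K' - K) * exp (- \<nu> * (\<theta> - \<theta>1))"
    by (rule comparison[OF u \<theta>1 _ _ _ kK(2) \<theta>]) (use side start in auto)
  moreover have "-1 * u x \<le> - k + 2 * (- k' - - k) * exp (- \<nu> * (\<theta> - \<theta>1))"
    by (rule comparison[OF u \<theta>1 _ _ _ _ \<theta>]) (use side start kK in auto)
  ultimately show ?thesis by simp
qed

lemma slice_nonempty: "\<theta>0 \<le> \<theta> \<Longrightarrow> spiral_slice r1 r2 \<theta> \<noteq> {}"
  using r1_less_r2[of \<theta>] by (auto simp: spiral_slice_def intro!: exI[of _ "r1 \<theta>"])

lemma slice_subset_full: "\<theta>0 \<le> \<theta> \<Longrightarrow> spiral_slice r1 r2 \<theta> \<subseteq> spiral_full \<theta>0 r1 r2"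
  by (auto simp: spiral_slice_def spiral_full_def)

lemma bounded_on_initial_slice:
  assumes "continuous_on (spiral_full \<theta>0 r1 r2) u"
  shows "bounded (u ` spiral_slice r1 r2 \<theta>0)"
proof -
  have e: "spiral_slice r1 r2 \<theta>0 = (\<lambda>r. polar r \<theta>0) ` {r1 \<theta>0..r2 \<theta>0}"
    by (auto simp: spiral_slice_def)
  have "compact (spiral_slice r1 r2 \<theta>0)"
    unfolding e by (intro compact_continuous_image continuous_on_polar continuous_intros) auto
  with assms slice_subset_full show ?thesis
    by (intro compact_imp_bounded compact_continuous_image) (auto intro: continuous_on_subset)
qed

text \<open>All bounds on \<open>u\<close> are finite: it is bounded on the sides by assumption, on the
  initial slice by compactness, and hence everywhere by \<open>two_sided_decay\<close> with equal constants.
  So the extended reals reduce to real arithmetic.\<close>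

theorem oscillation_estimates:
  assumes u: "C2_on (spiral_open \<theta>0 r1 r2) u" "continuous_on (spiral_full \<theta>0 r1 r2) u"
      "below_exp_growth r1 r2 u" "\<And>x. x \<in> spiral_open \<theta>0 r1 r2 \<Longrightarrow> elliptic_op A b u x = 0"
    and bdd: "bounded (u ` spiral_sides \<theta>0 r1 r2)"
  defines "\<gamma> \<equiv> spiral_sides \<theta>0 r1 r2" and "S \<equiv> spiral_slice r1 r2"
  shows "osc u (spiral_full \<theta>0 r1 r2) \<le> osc u (S \<theta>0 \<union> \<gamma>)" (is ?max)
    and "\<And>\<theta>. \<theta>0 \<le> \<theta> \<Longrightarrow> osc u (S \<theta>) \<le> osc u \<gamma> * ereal (1 - 2 * exp (- \<nu> * (\<theta> - \<theta>0)))
      + ereal 2 * osc u (S \<theta>0 \<union> \<gamma>) * ereal (exp (- \<nu> * (\<theta> - \<theta>0)))" (is "\<And>\<theta>. _ \<Longrightarrow> ?decay \<theta>")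
    and "Limsup at_top (\<lambda>\<theta>. osc u (S \<theta>)) \<le>
      Limsup at_top (\<lambda>\<theta>. ereal (side_max r1 r2 u \<theta>)) - Liminf at_top (\<lambda>\<theta>. ereal (side_min r1 r2 u \<theta>))"
      (is ?limsup)
proof -
  have sides: "polar (r1 \<theta>) \<theta> \<in> \<gamma>" "polar (r2 \<theta>) \<theta> \<in> \<gamma>" if "\<theta>0 \<le> \<theta>" for \<theta>
    using that by (auto simp: \<gamma>_def spiral_sides_def)
  have ne: "\<gamma> \<noteq> {}" using sides[of \<theta>0] by auto
  define K k K' k' where "K = Sup (u ` \<gamma>)" "k = Inf (u ` \<gamma>)"
    and "K' = Sup (u ` (S \<theta>0 \<union> \<gamma>))" "k' = Inf (u ` (S \<theta>0 \<union> \<gamma>))"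
  note Kk = this
  have bdd: "bounded (u ` \<gamma>)" "bounded (u ` (S \<theta>0 \<union> \<gamma>))"
    using bdd bounded_on_initial_slice[OF u(2)] by (auto simp: \<gamma>_def S_def image_Un)
  have ab: "bdd_above (u ` \<gamma>)" "bdd_below (u ` \<gamma>)"
    "bdd_above (u ` (S \<theta>0 \<union> \<gamma>))" "bdd_below (u ` (S \<theta>0 \<union> \<gamma>))"
    using bdd by (auto intro: bounded_imp_bdd_above bounded_imp_bdd_below)
  have in_\<gamma>: "u x \<in> {k..K}" if "x \<in> \<gamma>" for x
    using that ab by (auto simp: Kk intro: cINF_lower cSUP_upper)
  have in': "u x \<in> {k'..K'}" if "x \<in> S \<theta>0 \<union> \<gamma>" for x
    using that ab by (auto simp only: Kk atLeastAtMost_iff intro: cINF_lower cSUP_upper)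
  have kK: "k' \<le> k" "K \<le> K'" "k' \<le> K'"
    using in'[of "polar (r1 \<theta>0) \<theta>0"] sides[of \<theta>0] ne ab unfolding Kk
    by (auto intro!: cSup_subset_mono cInf_superset_mono)
  have osc_\<gamma>: "osc u \<gamma> = ereal (K - k)" and osc': "osc u (S \<theta>0 \<union> \<gamma>) = ereal (K' - k')"
    using osc_eq[OF ne bdd(1)] osc_eq[OF _ bdd(2)] ne by (auto simp: Kk)
  have full: "u x \<in> {k'..K'}" if "x \<in> S \<theta>" "\<theta>0 \<le> \<theta>" for x \<theta>
    using two_sided_decay[OF u order_refl, of k' K' k' K' \<theta> x] that in' sides by (auto simp: S_def)
  show ?max
    unfolding osc' using full slice_nonempty[of \<theta>0] slice_subset_full[of \<theta>0]
    by (intro osc_le) (auto simp: spiral_full_def S_def spiral_slice_def)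
  show "?decay \<theta>" if \<theta>: "\<theta>0 \<le> \<theta>" for \<theta>
  proof -
    define e where "e = exp (- \<nu> * (\<theta> - \<theta>0))"
    have "u x \<in> {k - 2 * (k - k') * e .. K + 2 * (K' - K) * e}" if "x \<in> S \<theta>" for x
      unfolding e_def using that in' in_\<gamma> sides kK
      by (intro two_sided_decay[OF u order_refl]) (auto simp: S_def \<theta>)
    then have "osc u (S \<theta>) \<le> ereal ((K + 2 * (K' - K) * e) - (k - 2 * (k - k') * e))"
      using slice_nonempty[OF \<theta>] by (intro osc_le) (auto simp: S_def)
    also have "\<dots> = osc u \<gamma> * ereal (1 - 2 * e) + ereal 2 * osc u (S \<theta>0 \<union> \<gamma>) * ereal e"
      by (simp add: osc_\<gamma> osc' algebra_simps)
    finally show ?thesis by (simp add: e_def)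
  qed
  let ?M = "\<lambda>\<theta>. ereal (side_max r1 r2 u \<theta>)" and ?m = "\<lambda>\<theta>. ereal (side_min r1 r2 u \<theta>)"
  have side_bounds: "k \<le> side_min r1 r2 u \<theta>" "side_min r1 r2 u \<theta> \<le> K"
    "k \<le> side_max r1 r2 u \<theta>" "side_max r1 r2 u \<theta> \<le> K" if "\<theta>0 \<le> \<theta>" for \<theta>
    using in_\<gamma>[OF sides(1)[OF that]] in_\<gamma>[OF sides(2)[OF that]]
    by (auto simp: side_max_def side_min_def)
  have ev: "\<forall>\<^sub>F \<theta> in at_top. \<theta>0 \<le> \<theta>" by (rule eventually_ge_at_top)
  have "Limsup at_top ?M \<le> ereal K" "ereal k \<le> Limsup at_top ?M"
    by (auto intro!: Limsup_bounded le_Limsup eventually_mono[OF ev] simp: side_bounds)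
  then obtain L where L: "Limsup at_top ?M = ereal L" by (cases "Limsup at_top ?M") auto
  have "Liminf at_top ?m \<le> ereal K" "ereal k \<le> Liminf at_top ?m"
    by (auto intro!: Liminf_le Liminf_bounded eventually_mono[OF ev] simp: side_bounds)
  then obtain l where l: "Liminf at_top ?m = ereal l" by (cases "Liminf at_top ?m") auto
  \<comment> \<open>The comparison is restarted at an angle \<open>\<theta>1\<close> beyond which the boundary values lie between
    \<open>l - h\<close> and \<open>L + h\<close>; the values on the slice at \<open>\<theta>1\<close> are then forgotten up to another \<open>h\<close>.\<close>
  have "Limsup at_top (\<lambda>\<theta>. osc u (S \<theta>)) \<le> ereal (L - l) + ereal \<eta>" if \<eta>: "0 < \<eta>" for \<eta>
  proof -
    define h where "h = \<eta> / 4"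
    have h: "0 < h" using \<eta> by (simp add: h_def)
    have "\<forall>\<^sub>F \<theta> in at_top. ?M \<theta> < ereal (L + h)" by (rule Limsup_lessD) (simp add: L h)
    moreover have "\<forall>\<^sub>F \<theta> in at_top. ereal (l - h) < ?m \<theta>" by (rule less_LiminfD) (simp add: l h)
    ultimately have "\<forall>\<^sub>F \<theta> in at_top. \<theta>0 \<le> \<theta> \<and> ?M \<theta> < ereal (L + h) \<and> ereal (l - h) < ?m \<theta>"
      using ev by eventually_elim auto
    then obtain \<theta>1 where "\<And>\<theta>. \<theta>1 \<le> \<theta> \<Longrightarrow> \<theta>0 \<le> \<theta> \<and> ?M \<theta> < ereal (L + h) \<and> ereal (l - h) < ?m \<theta>"
      unfolding eventually_at_top_linorder by blast
    then have \<theta>1: "\<theta>0 \<le> \<theta>1"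
      and side: "\<And>\<theta>. \<theta>1 \<le> \<theta> \<Longrightarrow> u (polar (r1 \<theta>) \<theta>) \<in> {l - h..L + h}"
        "\<And>\<theta>. \<theta>1 \<le> \<theta> \<Longrightarrow> u (polar (r2 \<theta>) \<theta>) \<in> {l - h..L + h}"
      by (force simp: side_max_def side_min_def)+
    define a c where "a = min (l - h) k'" and "c = max (L + h) K'"
    have bound: "u x \<in> {(l - h) - 2 * ((l - h) - a) * exp (- \<nu> * (\<theta> - \<theta>1)) ..
        (L + h) + 2 * (c - (L + h)) * exp (- \<nu> * (\<theta> - \<theta>1))}" if "\<theta>1 \<le> \<theta>" "x \<in> S \<theta>" for \<theta> x
      using that full[of _ \<theta>1] \<theta>1
      by (intro two_sided_decay[OF u \<theta>1 side])
        (auto simp: S_def a_def c_def intro: min.coboundedI2 max.coboundedI2)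
    have "\<forall>\<^sub>F \<theta> in at_top. 2 * ((l - h) - a) * exp (- \<nu> * (\<theta> - \<theta>1)) < h"
      "\<forall>\<^sub>F \<theta> in at_top. 2 * (c - (L + h)) * exp (- \<nu> * (\<theta> - \<theta>1)) < h"
    proof -
      have "((\<lambda>\<theta>. d * exp (- \<nu> * (\<theta> - \<theta>1))) \<longlongrightarrow> 0) at_top" for d
        using \<nu>_pos by real_asymp
      from order_tendstoD(2)[OF this h]
      show "\<forall>\<^sub>F \<theta> in at_top. 2 * ((l - h) - a) * exp (- \<nu> * (\<theta> - \<theta>1)) < h"
        "\<forall>\<^sub>F \<theta> in at_top. 2 * (c - (L + h)) * exp (- \<nu> * (\<theta> - \<theta>1)) < h" by blast+
    qed
    then have "\<forall>\<^sub>F \<theta> in at_top. osc u (S \<theta>) \<le> ereal ((L + 2 * h) - (l - 2 * h))"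
      using eventually_ge_at_top[of \<theta>1]
    proof eventually_elim
      case (elim \<theta>)
      have "l - 2 * h \<le> u x \<and> u x \<le> L + 2 * h" if "x \<in> S \<theta>" for x
        using bound[OF elim(3) that] elim(1,2) by simp
      then show ?case using slice_nonempty[of \<theta>] elim(3) \<theta>1 by (intro osc_le) (auto simp: S_def)
    qed
    then have "Limsup at_top (\<lambda>\<theta>. osc u (S \<theta>)) \<le> ereal ((L + 2 * h) - (l - 2 * h))"
      by (rule Limsup_bounded)
    then show ?thesis by (simp add: h_def add.commute)
  qed
  then have "Limsup at_top (\<lambda>\<theta>. osc u (S \<theta>)) \<le> ereal (L - l)" 
    by (rule ereal_le_epsilon2)
  then show ?limsup unfolding L l by simp
qed

end

section \<open>The theorem for spirals winding onto a circle\<close>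

text \<open>The inner radius decreases from each turn to the next, so its values along
  \<open>\<theta> + 2 \<pi> n\<close> decrease to the limit. This gives the positive lower bound for the radii.\<close>

lemma limit_le_if_decreasing_per_turn:
  fixes r1 r2 :: "real \<Rightarrow> real"
  assumes shrink: "\<And>\<theta>. \<theta>0 \<le> \<theta> \<Longrightarrow> r2 (\<theta> + 2 * pi) < r1 \<theta>"
    and less: "\<And>\<theta>. \<theta>0 \<le> \<theta> \<Longrightarrow> r1 \<theta> < r2 \<theta>"
    and lim: "(r1 \<longlongrightarrow> l) at_top" and \<theta>: "\<theta>0 \<le> \<theta>"
  shows "l \<le> r1 \<theta>"
proof -
  have le: "r1 (\<theta> + real n * (2 * pi)) \<le> r1 \<theta>" for n
  proof (induction n)
    case (Suc n)
    let ?t = "\<theta> + real n * (2 * pi)"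
    have t: "\<theta>0 \<le> ?t" using \<theta> by (simp add: add_increasing2)
    have e: "\<theta> + real (Suc n) * (2 * pi) = ?t + 2 * pi" by (simp add: algebra_simps)
    have "\<theta>0 \<le> ?t + 2 * pi" using t pi_gt_zero by linarith
    from less[OF this] shrink[OF t] Suc show ?case unfolding e by linarith
  qed simp
  have "filterlim (\<lambda>n. \<theta> + real n * (2 * pi)) at_top sequentially" by real_asymp
  from filterlim_compose[OF lim this] show ?thesis
    using le by (intro LIMSEQ_le_const2) auto
qed

lemma bounded_above_if_convergent:
  fixes f :: "real \<Rightarrow> real"
  assumes cont: "continuous_on {a..} f" and lim: "(f \<longlongrightarrow> l) at_top"
  obtains R where "\<And>x. a \<le> x \<Longrightarrow> f x \<le> R"
proof -
  have "\<forall>\<^sub>F x in at_top. f x < l + 1" by (rule order_tendstoD(2)[OF lim]) simp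
  then obtain T where T: "\<And>x. T \<le> x \<Longrightarrow> f x < l + 1" unfolding eventually_at_top_linorder by blast
  have "bounded (f ` {a..T})"
    using cont by (intro compact_imp_bounded compact_continuous_image) (auto intro: continuous_on_subset)
  then obtain B where "\<forall>x\<in>{a..T}. \<bar>f x\<bar> \<le> B" by (auto simp: bounded_iff)
  then have B: "f x \<le> B" if "a \<le> x" "x \<le> T" for x using that by (auto simp: abs_le_iff)
  have "f x \<le> max (l + 1) B" if "a \<le> x" for x
    using T[of x] B[of x] that by (cases "T \<le> x") auto
  then show thesis by (rule that)
qed

theorem corollary5p2:
  fixes \<theta>0 rstar c0 M1 M2 :: real
    and r1 r2 :: "real \<Rightarrow> real"
    and A :: "real^2 \<Rightarrow> real^2^2"
    and b :: "real^2 \<Rightarrow> real^2"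
  defines "U \<equiv> spiral_open \<theta>0 r1 r2"
    and "V \<equiv> spiral_full \<theta>0 r1 r2"
    and "\<gamma> \<equiv> spiral_sides \<theta>0 r1 r2"
    and "S \<equiv> spiral_slice r1 r2"
  assumes "continuous_on {\<theta>0..} r1" and "continuous_on {\<theta>0..} r2"
    and "\<And>\<theta>. \<theta>0 \<le> \<theta> \<Longrightarrow> 0 < r1 \<theta>" and "\<And>\<theta>. \<theta>0 \<le> \<theta> \<Longrightarrow> 0 < r2 \<theta>"
    and "\<And>\<theta>. \<theta>0 \<le> \<theta> \<Longrightarrow> r2 (\<theta> + 2 * pi) < r1 \<theta>"
    and "\<And>\<theta>. \<theta>0 \<le> \<theta> \<Longrightarrow> r1 \<theta> < r2 \<theta>"
    and "0 < rstar"
    and "(r1 \<longlongrightarrow> rstar) at_top" and "(r2 \<longlongrightarrow> rstar) at_top"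
    and "\<And>x. x \<in> U \<Longrightarrow> transpose (A x) = A x"
    and "0 < c0" and "0 < M1"
    and "\<And>x \<xi>. x \<in> U \<Longrightarrow> c0 * (norm \<xi>)\<^sup>2 \<le> \<xi> \<bullet> (A x *v \<xi>)"
    and "\<And>x. x \<in> U \<Longrightarrow> trace (A x) \<le> M1"
    and "0 \<le> M2" and "\<And>x. x \<in> U \<Longrightarrow> norm (b x) \<le> M2"
  shows "\<exists>C>0. \<exists>\<nu>>0. \<forall>u :: real^2 \<Rightarrow> real.
    C2_on U u \<longrightarrow> continuous_on V u \<longrightarrow> bounded (u ` \<gamma>) \<longrightarrow> below_exp_growth r1 r2 u \<longrightarrow>
    (\<forall>x\<in>U. elliptic_op A b u x = 0) \<longrightarrow>
      osc u V \<le> osc u (S \<theta>0 \<union> \<gamma>) \<and>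
      (\<forall>\<theta>\<ge>\<theta>0. osc u (S \<theta>) \<le>
         osc u \<gamma> * ereal (1 - C * exp (- \<nu> * (\<theta> - \<theta>0))) +
         ereal C * osc u (S \<theta>0 \<union> \<gamma>) * ereal (exp (- \<nu> * (\<theta> - \<theta>0)))) \<and>
      Limsup at_top (\<lambda>\<theta>. osc u (S \<theta>)) \<le>
        Limsup at_top (\<lambda>\<theta>. ereal (side_max r1 r2 u \<theta>)) -
        Liminf at_top (\<lambda>\<theta>. ereal (side_min r1 r2 u \<theta>))"
proof -
  obtain R where R: "\<And>\<theta>. \<theta>0 \<le> \<theta> \<Longrightarrow> r2 \<theta> \<le> R"
    using bounded_above_if_convergent assms(6,13) by blast
  have rstar: "rstar \<le> r1 \<theta>" if "\<theta>0 \<le> \<theta>" for \<theta>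
    using limit_le_if_decreasing_per_turn[OF assms(9,10,12) that] .
  interpret elliptic_spiral \<theta>0 rstar R c0 M1 M2 r1 r2 A b
    by unfold_locales (fact assms(5-)[unfolded U_def] R rstar)+
  have "osc u V \<le> osc u (S \<theta>0 \<union> \<gamma>) \<and>
      (\<forall>\<theta>\<ge>\<theta>0. osc u (S \<theta>) \<le>
         osc u \<gamma> * ereal (1 - 2 * exp (- \<nu> * (\<theta> - \<theta>0))) +
         ereal 2 * osc u (S \<theta>0 \<union> \<gamma>) * ereal (exp (- \<nu> * (\<theta> - \<theta>0)))) \<and>
      Limsup at_top (\<lambda>\<theta>. osc u (S \<theta>)) \<le>
        Limsup at_top (\<lambda>\<theta>. ereal (side_max r1 r2 u \<theta>)) -
        Liminf at_top (\<lambda>\<theta>. ereal (side_min r1 r2 u \<theta>))"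
    if "C2_on U u" "continuous_on V u" "bounded (u ` \<gamma>)" "below_exp_growth r1 r2 u"
      "\<forall>x\<in>U. elliptic_op A b u x = 0" for u
    using oscillation_estimates[of u] that unfolding U_def V_def \<gamma>_def S_def by blast
  then show ?thesis
    by (intro exI[of _ 2] exI[of _ \<nu>] conjI[OF zero_less_numeral] conjI[OF \<nu>_pos] allI impI) blast
qed

end
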